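(* Let $G$ be a finite, connected, simple undirected graph with vertices $v_0,\dots,v_n$ and edge set $E$. Label the regions of the $G$-semiorder arrangement by the following procedure: label the central region (the set of $x$ with $|x_i-x_j|<1$ for all $\{v_i,v_j\}\in E$) by $-1_V=-\sum_{k}v_k$ and put it in a queue; while the queue is nonempty, remove its first region $r$, and for each unlabeled region $r'$ bordering $r$, determine the unique indices $i\neq j$ such that $|x_i-x_j|<1$ on $r$ but $x_j>x_i+1$ on $r'$, label $r'$ by $\lambda(r)+v_j$, where $\lambda(r)$ is the label of $r$, and add $r'$ to the end of the queue. Let $\lambda(r)$ denote the resulting label of each region $r$. Then $\lambda=\psi\circ\tau$, where $\tau(r)$ is the partial orientation $\{(v_i,v_j):\{v_i,v_j\}\in E,\ x_j>x_i+1\text{ on }r\}$ and $\psi(\mathcal{O})=\sum_{v}(\mathrm{indeg}_{\mathcal{O}}(v)-1)v$. Consequently $\lambda$ is a surjection from the set of regions onto the set $\mathcal{S}$ of quasi-superstable divisors on $G$, and for every $\sigma\in\mathfrak{S}$ we have $\lambda\circ\rho\circ\eta_\sigma=\mathrm{id}_{\mathcal{S}}$, where $\eta_\sigma:\mathcal{S}\to\mathbb{O}$ is injective.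
   Context: The $G$-semiorder arrangement is the set of hyperplanes $x_i-x_j=1$ in $\mathbb{R}^{n+1}$ for all ordered pairs $i\neq j$ with $\{v_i,v_j\}\in E$; its regions are the connected components of the complement of their union. Divisors are elements of $\mathbb{Z}V$, $V=\{v_0,\dots,v_n\}$. Partial orientation: $\mathcal{O}\subseteq V\times V$ with $(u,v)\in\mathcal{O}\Rightarrow\{u,v\}\in E$, $(v,u)\notin\mathcal{O}$; non-oriented edges are blank; $\mathrm{indeg}_{\mathcal{O}}(v)=|\{u:(u,v)\in\mathcal{O}\}|$. A potential cycle is a cycle of $G$ whose blank edges can be directed to make it directed; $\mathbb{O}$ is the set of $G$-semiorientations (partial orientations whose potential cycles all have more blank than oriented edges). $\rho:\mathbb{O}\to\{\text{regions}\}$ sends $\mathcal{O}$ to the set of $x$ with $x_j>x_i+1$ for $(v_i,v_j)\in\mathcal{O}$ and $|x_i-x_j|<1$ for blank edges $\{v_i,v_j\}$; it is a bijection with inverse $\tau$. Sandpiles: for a graph $H$ with sink $s$, a configuration $c\ge0$ on nonsink vertices is superstable if no nonempty set $X$ of nonsink vertices has $c-\widetilde{\Delta}1_X\ge0$, with $\widetilde{\Delta}$ the Laplacian $D-A$ with the sink row/column deleted. $K(G)$ is $G$ plus a sink $\tilde q$ adjacent to every vertex of $V$. $\mathcal{S}$ is the set of $c\in\mathbb{Z}V$ with $c+1_V$ superstable on $K(G)$. $\mathfrak{S}$ is the symmetric group on $\{0,\dots,n\}$ ($\sigma$ identified with the ordering $v_{\sigma(0)},\dots,v_{\sigma(n)}$),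 and $\eta_\sigma(c)$ is the partial orientation produced by the following algorithm. A vertex $v\in V$ is unstable in a configuration $b$ on $K(G)$ if $b_v\ge\deg_{K(G)}(v)$; firing $v$ subtracts $\deg_{K(G)}(v)$ from $b_v$ and adds $1$ to each $G$-neighbor. Start with $b=\sum_v(\deg_{K(G)}(v)-1)v-c$, $\mathcal{O}=\emptyset$, and a queue consisting of the unstable vertices in order $\sigma$. While the queue is nonempty, remove its first vertex $w_0$ and fire it (each vertex is fired at most once); append the not-yet-fired vertices that just became unstable, in order $\sigma$; for each edge $\{w_0,v\}$ not yet oriented or marked blank, mark it blank if $v$ was unstable before this firing, and otherwise add $(w_0,v)$ to $\mathcal{O}$. Then $\eta_\sigma(c)=\mathcal{O}$. *)

theory Defs
  imports
    "HOL-Analysis.Analysis"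
    "HOL-Combinatorics.Permutations"
    "HOL-Library.While_Combinator"
begin

section \<open>Graphs\<close>

text \<open>A graph has the elements of the (finite) type as its vertices and is given by its edge set.\<close>

definition simple_graph :: "'v set set \<Rightarrow> bool" where
  "simple_graph E \<longleftrightarrow> (\<forall>e\<in>E. card e = 2)"

definition connected_graph :: "'v set set \<Rightarrow> bool" where
  "connected_graph E \<longleftrightarrow> (\<forall>u w. (u, w) \<in> {(a, b). {a, b} \<in> E}\<^sup>*)"

definition degree :: "'v set set \<Rightarrow> 'v \<Rightarrow> nat" where
  "degree E u = card {e \<in> E. u \<in> e}"

section \<open>Partial orientations and semiorientations\<close>

definition partial_orientation :: "'v set set \<Rightarrow> ('v \<times> 'v) set \<Rightarrow> bool" where
  "partial_orientation E P \<longleftrightarrow> (\<forall>(u, w)\<in>P. {u, w} \<in> E \<and> (w, u) \<notin> P)"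

definition oriented_edges :: "('v \<times> 'v) set \<Rightarrow> 'v set set" where
  "oriented_edges P = {{u, w} | u w. (u, w) \<in> P}"

definition blank_edges :: "'v set set \<Rightarrow> ('v \<times> 'v) set \<Rightarrow> 'v set set" where
  "blank_edges E P = E - oriented_edges P"

definition indeg :: "('v \<times> 'v) set \<Rightarrow> 'v \<Rightarrow> nat" where
  "indeg P w = card {u. (u, w) \<in> P}"

text \<open>A cycle is given by the list of its vertices, traversed in one of the two directions;
  the last vertex is joined to the first.\<close>

definition cycle_arcs :: "'v list \<Rightarrow> ('v \<times> 'v) set" where
  "cycle_arcs ws = set (zip ws (rotate1 ws))"

definition cycle_edges :: "'v list \<Rightarrow> 'v set set" where
  "cycle_edges ws = {{u, w} | u w. (u, w) \<in> cycle_arcs ws}"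

definition graph_cycle :: "'v set set \<Rightarrow> 'v list \<Rightarrow> bool" where
  "graph_cycle E ws \<longleftrightarrow> 3 \<le> length ws \<and> distinct ws \<and> cycle_edges ws \<subseteq> E"

definition potential_cycle :: "'v set set \<Rightarrow> ('v \<times> 'v) set \<Rightarrow> 'v list \<Rightarrow> bool" where
  "potential_cycle E P ws \<longleftrightarrow>
     graph_cycle E ws \<and> (\<exists>P'. partial_orientation E P' \<and> P \<subseteq> P' \<and> cycle_arcs ws \<subseteq> P')"

definition semiorientations :: "'v set set \<Rightarrow> ('v \<times> 'v) set set" where
  "semiorientations E = {P. partial_orientation E P \<and>
     (\<forall>ws. potential_cycle E P ws \<longrightarrow>
        card (cycle_edges ws \<inter> oriented_edges P) < card (cycle_edges ws \<inter> blank_edges E P))}"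

section \<open>The semiorder arrangement\<close>

text \<open>The ambient space has one coordinate for each vertex.\<close>

definition hyperplane :: "'v \<Rightarrow> 'v \<Rightarrow> (real ^ 'v) set" where
  "hyperplane i j = {x. x $ i - x $ j = 1}"

definition regions :: "'v::finite set set \<Rightarrow> (real ^ 'v) set set" where
  "regions E = components (UNIV - (\<Union>(i, j) \<in> {(i, j). i \<noteq> j \<and> {i, j} \<in> E}. hyperplane i j))"

text \<open>Two regions border each other if they have a common facet (not merely a common boundary point).\<close>

definition borders :: "(real ^ 'v::finite) set \<Rightarrow> (real ^ 'v) set \<Rightarrow> bool" where
  "borders r r' \<longleftrightarrow> r \<noteq> r' \<and> (\<exists>F. F facet_of closure r \<and> F facet_of closure r')"

definition central_region :: "'v::finite set set \<Rightarrow> (real ^ 'v) set" where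
  "central_region E = {x. \<forall>i j. {i, j} \<in> E \<longrightarrow> \<bar>x $ i - x $ j\<bar> < 1}"

definition rho :: "'v::finite set set \<Rightarrow> ('v \<times> 'v) set \<Rightarrow> (real ^ 'v) set" where
  "rho E P = {x. (\<forall>(i, j)\<in>P. x $ j > x $ i + 1) \<and>
                 (\<forall>i j. {i, j} \<in> blank_edges E P \<longrightarrow> \<bar>x $ i - x $ j\<bar> < 1)}"

definition tau :: "'v::finite set set \<Rightarrow> (real ^ 'v) set \<Rightarrow> ('v \<times> 'v) set" where
  "tau E r = {(i, j). {i, j} \<in> E \<and> (\<forall>x\<in>r. x $ j > x $ i + 1)}"

section \<open>Divisors and quasi-superstability\<close>

text \<open>The divisor \<open>\<Sum>v. c v * v\<close> is represented by its coefficient function \<open>c :: 'v \<Rightarrow> int\<close>.\<close>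

definition psi :: "('v \<times> 'v) set \<Rightarrow> 'v \<Rightarrow> int" where
  "psi P = (\<lambda>w. int (indeg P w) - 1)"

definition laplacian :: "'w set set \<Rightarrow> 'w \<Rightarrow> 'w \<Rightarrow> int" where
  "laplacian H u w = (if u = w then int (degree H u) else 0) - (if {u, w} \<in> H then 1 else 0)"

text \<open>A configuration on a graph with sink \<open>s\<close> is a function whose value at \<open>s\<close> is ignored.\<close>

definition superstable :: "'w::finite set set \<Rightarrow> 'w \<Rightarrow> ('w \<Rightarrow> int) \<Rightarrow> bool" where
  "superstable H s c \<longleftrightarrow> (\<forall>u. u \<noteq> s \<longrightarrow> 0 \<le> c u) \<and>
     \<not> (\<exists>X. X \<noteq> {} \<and> s \<notin> X \<and>
          (\<forall>u. u \<noteq> s \<longrightarrow> 0 \<le> c u - (\<Sum>w \<in> UNIV - {s}. laplacian H u w * (if w \<in> X then 1 else 0))))"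

text \<open>The graph \<open>K(G)\<close> has vertex type \<open>'v option\<close>, and its sink is \<open>None\<close>.\<close>

definition cone_graph :: "'v set set \<Rightarrow> 'v option set set" where
  "cone_graph E = (\<lambda>e. Some ` e) ` E \<union> range (\<lambda>u. {Some u, None})"

definition quasi_superstable :: "'v::finite set set \<Rightarrow> ('v \<Rightarrow> int) set" where
  "quasi_superstable E = {c. superstable (cone_graph E) None (case_option 0 (\<lambda>u. c u + 1))}"

section \<open>The region labeling\<close>

text \<open>
  A state consists of the queue and the partial map of labels given so far.  The order in which the
  unlabeled neighbours of a region are visited is left open by the procedure; it is prescribed here
  by a function \<open>enum\<close> that lists the elements of a finite set.  All orders are covered, because a
  nonempty set of unlabeled neighbours occurs at most once in a run.
\<close>

type_synonym 'v label_state =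
  "(real ^ 'v) set list \<times> ((real ^ 'v) set \<Rightarrow> ('v \<Rightarrow> int) option)"

definition crosses :: "(real ^ 'v::finite) set \<Rightarrow> (real ^ 'v) set \<Rightarrow> 'v \<times> 'v \<Rightarrow> bool" where
  "crosses r r' = (\<lambda>(i, j). i \<noteq> j \<and> (\<forall>x\<in>r. \<bar>x $ i - x $ j\<bar> < 1) \<and> (\<forall>x\<in>r'. x $ j > x $ i + 1))"

definition unlabeled_neighbours ::
    "'v::finite set set \<Rightarrow> ((real ^ 'v) set \<Rightarrow> ('v \<Rightarrow> int) option) \<Rightarrow> (real ^ 'v) set \<Rightarrow> (real ^ 'v) set set" where
  "unlabeled_neighbours E L r = {r' \<in> regions E. borders r r' \<and> L r' = None}"

definition label_init :: "'v::finite set set \<Rightarrow> 'v label_state" where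
  "label_init E = ([central_region E], [central_region E \<mapsto> (\<lambda>w. - 1)])"

definition label_step ::
    "'v::finite set set \<Rightarrow> ((real ^ 'v) set set \<Rightarrow> (real ^ 'v) set list) \<Rightarrow> 'v label_state \<Rightarrow> 'v label_state" where
  "label_step E enum = (\<lambda>(Q, L). case Q of
       [] \<Rightarrow> (Q, L)
     | r # Q' \<Rightarrow>
         let rs = enum (unlabeled_neighbours E L r) in
         (Q' @ rs,
          \<lambda>r'. if r' \<in> set rs
               then let j = snd (THE p. crosses r r' p)
                    in Some (\<lambda>w. the (L r) w + (if w = j then 1 else 0))
               else L r'))"

definition label_run ::
    "'v::finite set set \<Rightarrow> ((real ^ 'v) set set \<Rightarrow> (real ^ 'v) set list) \<Rightarrow> 'v label_state option" where
  "label_run E enum = while_option (\<lambda>(Q, L). Q \<noteq> []) (label_step E enum) (label_init E)"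

definition region_label ::
    "'v::finite set set \<Rightarrow> ((real ^ 'v) set set \<Rightarrow> (real ^ 'v) set list) \<Rightarrow> (real ^ 'v) set \<Rightarrow> 'v \<Rightarrow> int" where
  "region_label E enum r = the (snd (the (label_run E enum)) r)"

section \<open>The firing algorithm\<close>

text \<open>Here configurations on \<open>K(G)\<close> are functions on the nonsink vertices.\<close>

definition unstable :: "'v set set \<Rightarrow> ('v \<Rightarrow> int) \<Rightarrow> 'v \<Rightarrow> bool" where
  "unstable E b u \<longleftrightarrow> b u \<ge> int (degree (cone_graph E) (Some u))"

definition fire :: "'v set set \<Rightarrow> 'v \<Rightarrow> ('v \<Rightarrow> int) \<Rightarrow> 'v \<Rightarrow> int" where
  "fire E w b = (\<lambda>u. b u - (if u = w then int (degree (cone_graph E) (Some w)) else 0)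
                         + (if {u, w} \<in> E then 1 else 0))"

text \<open>
  A state \<open>(Q, F, b, P, B)\<close> consists of the queue, the set of vertices fired so far, the current
  configuration, the partial orientation and the set of edges marked blank.  The list \<open>vs\<close> is the
  ordering of the vertices.
\<close>

type_synonym 'v firing_state =
  "'v list \<times> 'v set \<times> ('v \<Rightarrow> int) \<times> ('v \<times> 'v) set \<times> 'v set set"

definition eta_init :: "'v set set \<Rightarrow> 'v list \<Rightarrow> ('v \<Rightarrow> int) \<Rightarrow> 'v firing_state" where
  "eta_init E vs c =
     (let b = (\<lambda>u. int (degree (cone_graph E) (Some u)) - 1 - c u)
      in (filter (unstable E b) vs, {}, b, {}, {}))"

definition eta_step :: "'v set set \<Rightarrow> 'v list \<Rightarrow> 'v firing_state \<Rightarrow> 'v firing_state" where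
  "eta_step E vs = (\<lambda>(Q, F, b, P, B).
     let w = hd Q;
         F' = insert w F;
         b' = fire E w b;
         new = filter (\<lambda>u. u \<notin> F' \<and> unstable E b' u \<and> \<not> unstable E b u) vs;
         U = {u. {w, u} \<in> E \<and> (w, u) \<notin> P \<and> (u, w) \<notin> P \<and> {w, u} \<notin> B}
     in (tl Q @ new, F', b',
         P \<union> {(w, u) | u. u \<in> U \<and> \<not> unstable E b u},
         B \<union> {{w, u} | u. u \<in> U \<and> unstable E b u}))"

definition eta :: "'v set set \<Rightarrow> 'v list \<Rightarrow> ('v \<Rightarrow> int) \<Rightarrow> ('v \<times> 'v) set" where
  "eta E vs c =
     (case the (while_option (\<lambda>(Q, _). Q \<noteq> []) (eta_step E vs) (eta_init E vs c)) of
        (Q, F, b, P, B) \<Rightarrow> P)"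

end

theory Submission
  imports Defs
begin

text \<open>Regions correspond to their sets of far arcs \<open>P\<close>, and bordering regions differ in exactly one
  arc, because a facet spans a unique hyperplane.  Shrinking a generic point of a region towards the
  origin crosses a wall that removes an arc, so the graph distance of a region to the central one is
  \<open>card P\<close>; a breadth-first search therefore only ever crosses outwards, adding one to the indegree
  at the head of the new arc.  The divisors \<open>psi P\<close> are quasi-superstable, as in any nonempty set of
  vertices one with minimal coordinate has all its in-neighbours outside the set.  Conversely, the
  firing algorithm is a burning algorithm: superstability forces every vertex \<open>u\<close> to fire, and
  exactly \<open>c u + 1\<close> of its neighbours fire before or when it becomes unstable.  The time intervals
  between becoming unstable and firing are not nested, as the queue is first-in first-out; hence they
  can be replaced by unit intervals, and the positions of these form a point of the region \<open>rho E (\<eta> c)\<close>.\<close>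

section \<open>The regions of the arrangement\<close>

text \<open>Puts the wall of an arc into the form \<open>arc_normal i j \<bullet> x = 1\<close>, so
  that facts on half-spaces, hyperplanes and affine dimension apply.\<close>

definition arc_normal :: "'v::finite \<Rightarrow> 'v \<Rightarrow> real ^ 'v" where
  "arc_normal i j = axis j 1 - axis i 1"

lemma inner_arc_normal [simp]: "arc_normal i j \<bullet> x = x $ j - x $ i"
  by (simp add: arc_normal_def inner_diff_left inner_axis' inner_axis_axis)

lemma arc_normal_nth: "arc_normal i j $ k = (if k = j then 1 else 0) - (if k = i then 1 else 0)"
  by (auto simp: arc_normal_def axis_def)

lemma arc_normal_inject:
  assumes "i \<noteq> j" "k \<noteq> l" "arc_normal i j = arc_normal k l"
  shows "i = k \<and> j = l"
proof -
  have eq: "arc_normal i j $ m = arc_normal k l $ m" for m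
    using assms(3) by simp
  have "j = l"
    using eq[of j] assms(1) by (auto simp: arc_normal_nth split: if_splits)
  moreover have "i = k"
    using eq[of i] assms(1) by (auto simp: arc_normal_nth split: if_splits)
  ultimately show ?thesis by simp
qed

lemma arc_normal_nonzero: "i \<noteq> j \<Longrightarrow> arc_normal i j \<noteq> 0"
  using arc_normal_nth[of i j j] by auto

lemma simple_graph_neq: "simple_graph E \<Longrightarrow> {i, j} \<in> E \<Longrightarrow> i \<noteq> j"
  by (auto simp: simple_graph_def)

lemma blank_edges_iff: "{i, j} \<in> blank_edges E P \<longleftrightarrow> {i, j} \<in> E \<and> (i, j) \<notin> P \<and> (j, i) \<notin> P"
  by (auto simp: blank_edges_def oriented_edges_def doubleton_eq_iff)

lemma rho_iff:
  "x \<in> rho E P \<longleftrightarrow> (\<forall>(i, j)\<in>P. x $ j > x $ i + 1) \<and>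
     (\<forall>i j. {i, j} \<in> E \<longrightarrow> (i, j) \<notin> P \<longrightarrow> (j, i) \<notin> P \<longrightarrow> \<bar>x $ i - x $ j\<bar> < 1)"
  by (auto simp: rho_def blank_edges_iff)

text \<open>Pointwise counterpart of \<open>tau\<close>: it is constant on each region, with value
  \<open>tau\<close> of that region.\<close>

definition far_arcs :: "'v::finite set set \<Rightarrow> real ^ 'v \<Rightarrow> ('v \<times> 'v) set" where
  "far_arcs E x = {(i, j). {i, j} \<in> E \<and> x $ j > x $ i + 1}"

text \<open>Since \<open>{i, j} = {j, i}\<close>, the one inequation runs over both orientations of
  an edge and so avoids both of its hyperplanes.\<close>

definition arrangement_complement :: "'v::finite set set \<Rightarrow> (real ^ 'v) set" where
  "arrangement_complement E = {x. \<forall>i j. {i, j} \<in> E \<longrightarrow> x $ j - x $ i \<noteq> 1}"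

lemma regions_eq_components:
  assumes "simple_graph E"
  shows "regions E = components (arrangement_complement E)"
proof -
  have "UNIV - (\<Union>(i, j) \<in> {(i, j). i \<noteq> j \<and> {i, j} \<in> E}. hyperplane i j) = arrangement_complement E"
    using simple_graph_neq[OF assms]
    by (auto simp: arrangement_complement_def hyperplane_def insert_commute)
  then show ?thesis
    by (simp add: regions_def)
qed

section \<open>Regions as the nonempty cells \<open>rho E P\<close>\<close>

lemma partial_orientationD:
  assumes "partial_orientation E P" "(i, j) \<in> P"
  shows "{i, j} \<in> E" "(j, i) \<notin> P"
  using assms by (auto simp: partial_orientation_def)

lemma partial_orientation_far_arcs: "partial_orientation E (far_arcs E x)"
  by (auto simp: partial_orientation_def far_arcs_def)

text \<open>Off the hyperplanes an edge has three possible states: far in one direction, far in the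
  other, or shorter than 1. The inequalities of \<open>rho\<close> prescribe this state for every
  edge.\<close>

lemma mem_rho_iff:
  assumes "partial_orientation E P"
  shows "x \<in> rho E P \<longleftrightarrow> x \<in> arrangement_complement E \<and> far_arcs E x = P"
proof
  assume x: "x \<in> rho E P"
  have *: "x $ j - x $ i \<noteq> 1 \<and> (x $ j > x $ i + 1 \<longleftrightarrow> (i, j) \<in> P)" if "{i, j} \<in> E" for i j
  proof -
    consider "(i, j) \<in> P" | "(j, i) \<in> P" "(i, j) \<notin> P" | "(i, j) \<notin> P" "(j, i) \<notin> P"
      by blast
    then show ?thesis
    proof cases
      case 3
      then have "\<bar>x $ i - x $ j\<bar> < 1" using x that by (auto simp: rho_iff)
      then show ?thesis using 3 by auto
    qed (use x in \<open>auto simp: rho_iff\<close>)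
  qed
  have "far_arcs E x = P"
    using * partial_orientationD(1)[OF assms] by (auto simp: far_arcs_def)
  with * show "x \<in> arrangement_complement E \<and> far_arcs E x = P"
    by (auto simp: arrangement_complement_def)
next
  assume x: "x \<in> arrangement_complement E \<and> far_arcs E x = P"
  have "\<bar>x $ i - x $ j\<bar> < 1" if "{i, j} \<in> E" "(i, j) \<notin> P" "(j, i) \<notin> P" for i j
  proof -
    have "{j, i} \<in> E" using that by (simp add: insert_commute)
    then have "x $ j - x $ i \<noteq> 1" "x $ i - x $ j \<noteq> 1" "\<not> x $ j > x $ i + 1" "\<not> x $ i > x $ j + 1"
      using x that unfolding arrangement_complement_def far_arcs_def by auto
    then show ?thesis by linarith
  qed
  then show "x \<in> rho E P"
    using x by (auto simp: rho_iff far_arcs_def)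
qed

text \<open>Antisymmetry comes for free from a point: opposite arcs would impose contradictory
  inequalities.\<close>

lemma partial_orientation_of_rho:
  assumes "x \<in> rho E P" "P \<subseteq> {(i, j). {i, j} \<in> E}"
  shows "partial_orientation E P"
proof -
  have "{i, j} \<in> E \<and> (j, i) \<notin> P" if "(i, j) \<in> P" for i j
  proof -
    have "x $ j > x $ i + 1" "(j, i) \<in> P \<Longrightarrow> x $ i > x $ j + 1"
      using assms(1) that by (auto simp: rho_iff)
    then show ?thesis using assms(2) that by fastforce
  qed
  then show ?thesis by (auto simp: partial_orientation_def)
qed

lemma tau_rho:
  assumes "partial_orientation E P" "rho E P \<noteq> {}"
  shows "tau E (rho E P) = P"
proof -
  have "far_arcs E x = P" if "x \<in> rho E P" for x
    using that mem_rho_iff[OF assms(1)] by auto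
  then have "tau E (rho E P) = {(i, j). {i, j} \<in> E \<and> (\<forall>x\<in>rho E P. (i, j) \<in> P)}"
    unfolding tau_def far_arcs_def by blast
  then show ?thesis
    using assms partial_orientationD(1)[OF assms(1)] by auto
qed

text \<open>The set of blank ordered pairs is closed under swapping, so each absolute value splits
  into two half-spaces. Openness and convexity then follow from those of half-spaces.\<close>

lemma rho_eq_Inter:
  fixes E :: "'v::finite set set"
  shows "rho E P = (\<Inter>(i, j)\<in>P. {x. arc_normal i j \<bullet> x > 1}) \<inter>
     (\<Inter>(i, j)\<in>{(i, j). {i, j} \<in> E \<and> (i, j) \<notin> P \<and> (j, i) \<notin> P}. {x. arc_normal i j \<bullet> x < 1})"
  (is "_ = ?R")
proof (rule set_eqI)
  fix x :: "real ^ 'v"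
  have "(\<forall>i j. {i, j} \<in> E \<longrightarrow> (i, j) \<notin> P \<longrightarrow> (j, i) \<notin> P \<longrightarrow> \<bar>x $ i - x $ j\<bar> < 1) \<longleftrightarrow>
        (\<forall>i j. {i, j} \<in> E \<longrightarrow> (i, j) \<notin> P \<longrightarrow> (j, i) \<notin> P \<longrightarrow> x $ j - x $ i < 1)" (is "?A \<longleftrightarrow> ?B")
  proof
    assume B: ?B
    show ?A
    proof (intro allI impI)
      fix i j assume "{i, j} \<in> E" "(i, j) \<notin> P" "(j, i) \<notin> P"
      then have "x $ j - x $ i < 1" "x $ i - x $ j < 1"
        using B[rule_format, of i j] B[rule_format, of j i] by (simp_all add: insert_commute)
      then show "\<bar>x $ i - x $ j\<bar> < 1" by linarith
    qed
  qed fastforce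
  then show "x \<in> rho E P \<longleftrightarrow> x \<in> ?R"
    by (auto simp: rho_iff algebra_simps)
qed

lemma open_rho: "open (rho E P)"
  unfolding rho_eq_Inter
  by (intro open_Int open_INT finite) (auto simp only: split: prod.splits intro: open_halfspace_lt open_halfspace_gt)

lemma convex_rho: "convex (rho E P)"
  unfolding rho_eq_Inter
  by (intro convex_Int convex_INT) (auto simp only: split: prod.splits intro: convex_halfspace_lt convex_halfspace_gt)

text \<open>A cell is convex, hence connected, and so lies in the component. Conversely, if the
  status of an arc differed at two points of a connected set, the intermediate value theorem would
  put a point of that set on the hyperplane.\<close>

lemma connected_component_arrangement_complement:
  assumes "x \<in> arrangement_complement E"
  shows "connected_component_set (arrangement_complement E) x = rho E (far_arcs E x)"
proof
  have x: "x \<in> rho E (far_arcs E x)"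
    using assms by (simp add: mem_rho_iff partial_orientation_far_arcs)
  have "rho E (far_arcs E x) \<subseteq> arrangement_complement E"
    by (auto simp: mem_rho_iff partial_orientation_far_arcs)
  with x show "rho E (far_arcs E x) \<subseteq> connected_component_set (arrangement_complement E) x"
    by (intro connected_component_maximal convex_connected convex_rho)
  show "connected_component_set (arrangement_complement E) x \<subseteq> rho E (far_arcs E x)"
  proof
    fix y assume "y \<in> connected_component_set (arrangement_complement E) x"
    then obtain C where C: "connected C" "C \<subseteq> arrangement_complement E" "x \<in> C" "y \<in> C"
      by (auto simp: connected_component_def)
    have "(x $ j > x $ i + 1) = (y $ j > y $ i + 1)" if "{i, j} \<in> E" for i j
    proof (rule ccontr)
      assume "(x $ j > x $ i + 1) \<noteq> (y $ j > y $ i + 1)"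
      then have "(arc_normal i j \<bullet> x \<le> 1 \<and> 1 \<le> arc_normal i j \<bullet> y) \<or>
          (arc_normal i j \<bullet> y \<le> 1 \<and> 1 \<le> arc_normal i j \<bullet> x)"
        by auto
      then obtain z where "z \<in> C" "arc_normal i j \<bullet> z = 1"
        using connected_ivt_hyperplane[OF C(1)] C(3,4) by metis
      with C(2) that show False
        by (auto simp: arrangement_complement_def)
    qed
    then have "far_arcs E y = far_arcs E x"
      by (auto simp: far_arcs_def)
    with C show "y \<in> rho E (far_arcs E x)"
      by (auto simp: mem_rho_iff partial_orientation_far_arcs)
  qed
qed

lemma regions_eq:
  assumes "simple_graph E"
  shows "regions E = {rho E P | P. partial_orientation E P \<and> rho E P \<noteq> {}}"
proof -
  have "regions E = (\<lambda>x. rho E (far_arcs E x)) ` arrangement_complement E"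
    using connected_component_arrangement_complement
    by (auto simp: regions_eq_components[OF assms] components_def)
  also have "\<dots> = {rho E P | P. partial_orientation E P \<and> rho E P \<noteq> {}}"
  proof (intro subset_antisym subsetI)
    fix r assume "r \<in> (\<lambda>x. rho E (far_arcs E x)) ` arrangement_complement E"
    then show "r \<in> {rho E P | P. partial_orientation E P \<and> rho E P \<noteq> {}}"
      using mem_rho_iff partial_orientation_far_arcs by blast
  next
    fix r assume "r \<in> {rho E P | P. partial_orientation E P \<and> rho E P \<noteq> {}}"
    then obtain P x where "r = rho E P" "partial_orientation E P" "x \<in> rho E P" by auto
    then have "x \<in> arrangement_complement E" "r = rho E (far_arcs E x)"
      by (auto simp: mem_rho_iff)
    then show "r \<in> (\<lambda>x. rho E (far_arcs E x)) ` arrangement_complement E" by blast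
  qed
  finally show ?thesis .
qed

lemma regionE:
  assumes "simple_graph E" "r \<in> regions E"
  obtains P where "r = rho E P" "partial_orientation E P" "rho E P \<noteq> {}" "tau E r = P"
  using assms tau_rho by (fastforce simp: regions_eq)

lemma rho_in_regions:
  assumes "simple_graph E" "partial_orientation E P" "rho E P \<noteq> {}"
  shows "rho E P \<in> regions E"
  using assms by (auto simp: regions_eq)

lemma finite_regions:
  assumes "simple_graph E"
  shows "finite (regions E)"
  by (rule finite_subset[of _ "range (rho E)"]) (auto simp: regions_eq[OF assms])

lemma central_region_eq: "central_region E = rho E {}"
  by (auto simp: central_region_def rho_iff)

lemma central_region_nonempty: "rho E {} \<noteq> {}"
proof -
  have "0 \<in> rho E {}" by (simp add: rho_iff)
  then show ?thesis by blast
qed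

lemma closure_rho:
  assumes "rho E P \<noteq> {}"
  shows "closure (rho E P) = {x. (\<forall>(i, j)\<in>P. x $ j \<ge> x $ i + 1) \<and>
     (\<forall>i j. {i, j} \<in> E \<longrightarrow> (i, j) \<notin> P \<longrightarrow> (j, i) \<notin> P \<longrightarrow> \<bar>x $ i - x $ j\<bar> \<le> 1)}" (is "_ = ?C")
proof
  have "?C = (\<Inter>(i, j)\<in>P. {x. x $ j \<ge> x $ i + 1}) \<inter>
     (\<Inter>(i, j)\<in>{(i, j). {i, j} \<in> E \<and> (i, j) \<notin> P \<and> (j, i) \<notin> P}. {x. \<bar>x $ i - x $ j\<bar> \<le> 1})"
    by auto
  also have "closed \<dots>"
  proof -
    have "closed {x::real^'a. x $ j \<ge> x $ i + 1}" "closed {x::real^'a. \<bar>x $ i - x $ j\<bar> \<le> 1}" for i j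
      by (intro closed_Collect_le continuous_intros)+
    then show ?thesis
      by (intro closed_Int closed_INT) auto
  qed
  finally have "closed ?C" .
  moreover have "rho E P \<subseteq> ?C"
    by (fastforce simp: rho_iff)
  ultimately show "closure (rho E P) \<subseteq> ?C"
    by (rule closure_minimal[rotated])
  show "?C \<subseteq> closure (rho E P)"
  proof
    fix y assume y: "y \<in> ?C"
    obtain x where x: "x \<in> rho E P" using assms by blast
    \<comment> \<open>The half-open segment from \<open>y\<close> to a point \<open>x\<close> of the
      cell stays in the cell: a weak and a strict inequality combine to a strict one. Letting
      \<open>t\<close> tend to 0 exhibits \<open>y\<close> as a limit.\<close>
    have mem: "y + t *\<^sub>R (x - y) \<in> rho E P" if t: "0 < t" "t < 1" for t
    proof -
      let ?z = "y + t *\<^sub>R (x - y)"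
      have z: "?z $ a - ?z $ b = (1 - t) * (y $ a - y $ b) + t * (x $ a - x $ b)" for a b
        by (simp add: algebra_simps)
      have "?z $ b > ?z $ a + 1" if "(a, b) \<in> P" for a b
      proof -
        have "y $ b - y $ a \<ge> 1" "x $ b - x $ a > 1"
          using x y that by (auto simp: rho_iff)
        then have "(1 - t) * (y $ b - y $ a) \<ge> (1 - t) * 1" "t * (x $ b - x $ a) > t * 1"
          using t by (auto intro!: mult_left_mono)
        then show ?thesis using z[of b a] by simp
      qed
      moreover have "\<bar>?z $ a - ?z $ b\<bar> < 1" if "{a, b} \<in> E" "(a, b) \<notin> P" "(b, a) \<notin> P" for a b
      proof -
        have *: "\<bar>y $ a - y $ b\<bar> \<le> 1" "\<bar>x $ a - x $ b\<bar> < 1"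
          using x y that by (auto simp: rho_iff)
        have "\<bar>?z $ a - ?z $ b\<bar> \<le> \<bar>(1 - t) * (y $ a - y $ b)\<bar> + \<bar>t * (x $ a - x $ b)\<bar>"
          unfolding z by (rule abs_triangle_ineq)
        also have "\<dots> = (1 - t) * \<bar>y $ a - y $ b\<bar> + t * \<bar>x $ a - x $ b\<bar>"
          using t by (simp add: abs_mult)
        also have "\<dots> < (1 - t) * 1 + t * 1"
          using t * by (intro add_le_less_mono mult_left_mono mult_strict_left_mono) auto
        finally show ?thesis by simp
      qed
      ultimately show ?thesis by (auto simp: rho_iff)
    qed
    have "((\<lambda>t. y + t *\<^sub>R (x - y)) \<longlongrightarrow> y + 0 *\<^sub>R (x - y)) (at_right 0)"
      by (intro tendsto_intros)
    moreover have "eventually (\<lambda>t. y + t *\<^sub>R (x - y) \<in> closure (rho E P)) (at_right (0::real))"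
      using mem closure_subset[of "rho E P"] by (auto simp: eventually_at_right[of 0 1] intro!: exI[of _ 1])
    ultimately show "y \<in> closure (rho E P)"
      using Lim_in_closed_set[OF closed_closure] by force
  qed
qed

section \<open>Bordering regions\<close>

text \<open>A set of codimension one inside a hyperplane has that hyperplane as its affine hull, so
  the two hyperplanes coincide.\<close>

lemma facet_in_hyperplane_unique:
  fixes F :: "(real ^ 'v::finite) set"
  assumes "aff_dim F = int (CARD('v)) - 1"
    and "F \<subseteq> {x. x $ j - x $ i = 1}" "F \<subseteq> {x. x $ l - x $ k = 1}" "i \<noteq> j" "k \<noteq> l" "F \<noteq> {}"
  shows "(i, j) = (k, l)"
proof -
  have hull: "affine hull F = {x. arc_normal a b \<bullet> x = 1}" if "F \<subseteq> {x. x $ b - x $ a = 1}" "a \<noteq> b" for a b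
  proof (rule affine_dim_equal)
    show "affine hull F \<subseteq> {x. arc_normal a b \<bullet> x = 1}"
      by (rule hull_minimal) (use that affine_hyperplane[of "arc_normal a b" 1] in auto)
    show "aff_dim (affine hull F) = aff_dim {x. arc_normal a b \<bullet> x = 1}"
      using assms(1) arc_normal_nonzero[OF that(2)]
      by (subst aff_dim_hyperplane) auto
  qed (use assms(6) affine_hyperplane[of "arc_normal a b" 1] in auto)
  have eq: "{x. arc_normal i j \<bullet> x = 1} = {x. arc_normal k l \<bullet> x = 1}"
    using hull[OF assms(2,4)] hull[OF assms(3,5)] by simp
  \<comment> \<open>The indices are read off from two points of the common hyperplane:
    \<open>axis j 1\<close> determines the head, \<open>- axis i 1\<close> the tail.\<close>
  have "axis j 1 \<in> {x. arc_normal i j \<bullet> x = 1}"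
    using assms(4) by (simp add: axis_def)
  then have jl: "j = l"
    unfolding eq using assms(5) by (auto simp: axis_def split: if_splits)
  have "- axis i 1 \<in> {x. arc_normal i j \<bullet> x = 1}"
    using assms(4) by (simp add: axis_def)
  then have "i = k"
    unfolding eq using assms(4,5) jl by (auto simp: axis_def split: if_splits)
  with jl show ?thesis by simp
qed

text \<open>The weak inequalities pass to the closures, and a common facet satisfies both.\<close>

lemma facet_in_separating_hyperplane:
  fixes r r' :: "(real ^ 'v::finite) set"
  assumes "F facet_of closure r" "F facet_of closure r'"
    and "\<And>x. x \<in> r \<Longrightarrow> x $ j - x $ i \<le> 1" "\<And>x. x \<in> r' \<Longrightarrow> 1 \<le> x $ j - x $ i"
  shows "F \<subseteq> {x. x $ j - x $ i = 1}"
proof -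
  have "closed {x::real^'v. x $ j - x $ i \<le> 1}" "closed {x::real^'v. 1 \<le> x $ j - x $ i}"
    by (intro closed_Collect_le continuous_intros)+
  moreover have "r \<subseteq> {x. x $ j - x $ i \<le> 1}" "r' \<subseteq> {x. 1 \<le> x $ j - x $ i}"
    using assms(3,4) by auto
  ultimately have "closure r \<subseteq> {x. x $ j - x $ i \<le> 1}" "closure r' \<subseteq> {x. 1 \<le> x $ j - x $ i}"
    by (simp_all add: closure_minimal)
  moreover have "F \<subseteq> closure r" "F \<subseteq> closure r'"
    using assms(1,2) by (auto simp: facet_of_def dest: face_of_imp_subset)
  ultimately show ?thesis by fastforce
qed

lemma aff_dim_facet_of_open:
  fixes r :: "(real ^ 'v::finite) set"
  assumes "F facet_of closure r" "open r" "r \<noteq> {}"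
  shows "aff_dim F = int CARD('v) - 1" "F \<noteq> {}"
  using assms by (auto simp: facet_of_def aff_dim_open)

lemma crosses_unique:
  assumes "open r" "r \<noteq> {}" "F facet_of closure r" "F facet_of closure r'"
    and "crosses r r' p" "crosses r r' q"
  shows "p = q"
proof -
  obtain i j k l where pq: "p = (i, j)" "q = (k, l)" by fastforce
  have "F \<subseteq> {x. x $ b - x $ a = 1}" if "crosses r r' (a, b)" for a b
    by (rule facet_in_separating_hyperplane[OF assms(3,4)]) (use that in \<open>fastforce simp: crosses_def abs_less_iff\<close>)+
  moreover have "i \<noteq> j" "k \<noteq> l"
    using assms(5,6) pq by (auto simp: crosses_def)
  ultimately show ?thesis
    unfolding pq
    using facet_in_hyperplane_unique[OF aff_dim_facet_of_open(1)[OF assms(3,1,2)]]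
      aff_dim_facet_of_open(2)[OF assms(3,1,2)] assms(5,6)[unfolded pq] by blast
qed

text \<open>Every arc on which \<open>P\<close> and \<open>P'\<close> disagree gives a hyperplane
  through the common facet, and the facet spans only one.\<close>

lemma borders_rho:
  assumes "simple_graph E" and P: "partial_orientation E P" "rho E P \<noteq> {}"
    and P': "partial_orientation E P'" "rho E P' \<noteq> {}" and "borders (rho E P) (rho E P')"
  obtains a where "a \<notin> P" "P' = insert a P" | a where "a \<notin> P'" "P = insert a P'"
proof -
  obtain F where F: "F facet_of closure (rho E P)" "F facet_of closure (rho E P')"
    and neq: "rho E P \<noteq> rho E P'"
    using assms(6) by (auto simp: borders_def)
  have sep: "F \<subseteq> {x. x $ j - x $ i = 1}" if "partial_orientation E R" "partial_orientation E R'"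
      "F facet_of closure (rho E R)" "F facet_of closure (rho E R')"
      "(i, j) \<in> R' - R" for i j R R'
  proof (rule facet_in_separating_hyperplane[OF that(3,4)])
    fix x assume "x \<in> rho E R"
    moreover have "{i, j} \<in> E"
      using that partial_orientationD(1) by fastforce
    ultimately show "x $ j - x $ i \<le> 1"
      using that mem_rho_iff by (fastforce simp: far_arcs_def)
  next
    fix x assume "x \<in> rho E R'"
    then show "1 \<le> x $ j - x $ i"
      using that by (fastforce simp: rho_iff)
  qed
  \<comment> \<open>This also excludes the reversal of an arc, which would contribute two elements
    to the symmetric difference.\<close>
  have one: "a = b" if "a \<in> (P - P') \<union> (P' - P)" "b \<in> (P - P') \<union> (P' - P)" for a b
  proof -
    obtain i j k l where ab: "a = (i, j)" "b = (k, l)" by fastforce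
    have "F \<subseteq> {x. x $ j - x $ i = 1}" "F \<subseteq> {x. x $ l - x $ k = 1}"
      using that sep[OF P(1) P'(1) F] sep[OF P'(1) P(1) F(2,1)] unfolding ab by blast+
    moreover have "i \<noteq> j" "k \<noteq> l"
      using that partial_orientationD(1)[OF P(1)] partial_orientationD(1)[OF P'(1)]
        simple_graph_neq[OF assms(1)] unfolding ab by blast+
    ultimately show ?thesis
      unfolding ab using facet_in_hyperplane_unique[OF aff_dim_facet_of_open(1)[OF F(1) open_rho P(2)]]
        aff_dim_facet_of_open(2)[OF F(1) open_rho P(2)] by blast
  qed
  have "P \<noteq> P'" using neq by auto
  then obtain a where a: "a \<in> (P - P') \<union> (P' - P)" by blast
  have sub: "P - P' \<subseteq> {a}" "P' - P \<subseteq> {a}"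
    using one[OF _ a] by auto
  show ?thesis
  proof (cases "a \<in> P")
    case True
    then have "a \<notin> P'" using a by simp
    moreover have "P = insert a P'" using True sub by auto
    ultimately show ?thesis by (rule that(2))
  next
    case False
    then have "P' = insert a P" using a sub by auto
    with False show ?thesis by (rule that(1))
  qed
qed

text \<open>Identifies the pair that the labeling step selects by a definite description.\<close>

lemma borders_insert_crosses:
  assumes "simple_graph E" "rho E P \<noteq> {}" "partial_orientation E (insert (i, j) P)"
    and "(i, j) \<notin> P" "borders (rho E P) (rho E (insert (i, j) P))"
  shows "crosses (rho E P) (rho E (insert (i, j) P)) p \<longleftrightarrow> p = (i, j)"
proof -
  have "{i, j} \<in> E" "(j, i) \<notin> P"
    using assms(3) by (auto simp: partial_orientation_def)
  then have "crosses (rho E P) (rho E (insert (i, j) P)) (i, j)"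
    using assms(4) simple_graph_neq[OF assms(1)] by (auto simp: crosses_def rho_iff)
  moreover obtain F where "F facet_of closure (rho E P)" "F facet_of closure (rho E (insert (i, j) P))"
    using assms(5) by (auto simp: borders_def)
  ultimately show ?thesis
    using crosses_unique[OF open_rho assms(2)] by blast
qed

text \<open>Each coincidence of two arc lengths confines \<open>x\<close> to a hyperplane through 0,
  because distinct arcs have distinct normals. Finitely many hyperplanes are negligible, whereas a
  nonempty open set is not.\<close>

lemma generic_point:
  fixes S :: "(real ^ 'v::finite) set" and P :: "('v \<times> 'v) set"
  assumes "open S" "S \<noteq> {}" "\<And>i j. (i, j) \<in> P \<Longrightarrow> i \<noteq> j"
  obtains x where "x \<in> S" "inj_on (\<lambda>(i, j). x $ j - x $ i) P"
proof -
  let ?N = "\<lambda>(a, b). {x :: real ^ 'v. (arc_normal (fst a) (snd a) - arc_normal (fst b) (snd b)) \<bullet> x = 0}"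
  let ?I = "{(a, b). a \<in> P \<and> b \<in> P \<and> a \<noteq> b}"
  have "negligible (\<Union> (?N ` ?I))"
  proof (intro negligible_Union)
    fix T assume "T \<in> ?N ` ?I"
    then obtain a b where ab: "a \<in> P" "b \<in> P" "a \<noteq> b" and T: "T = ?N (a, b)" by blast
    have "arc_normal (fst a) (snd a) \<noteq> arc_normal (fst b) (snd b)"
      using arc_normal_inject assms(3) ab by (metis prod.collapse)
    then show "negligible T"
      unfolding T by (auto simp del: inner_arc_normal intro!: negligible_hyperplane)
  qed simp
  then have "\<not> S \<subseteq> \<Union> (?N ` ?I)"
    using open_not_negligible[OF assms(1,2)] negligible_subset by blast
  then obtain x where "x \<in> S" and x: "x \<notin> \<Union> (?N ` ?I)" by blast
  have "inj_on (\<lambda>(i, j). x $ j - x $ i) P"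
  proof (rule inj_onI)
    fix a b assume ab: "a \<in> P" "b \<in> P" "(\<lambda>(i, j). x $ j - x $ i) a = (\<lambda>(i, j). x $ j - x $ i) b"
    then have "x \<in> ?N (a, b)" by (simp add: inner_diff_left split_beta)
    with x ab show "a = b" by blast
  qed
  with \<open>x \<in> S\<close> that show ?thesis by blast
qed

text \<open>Shrinking a generic point of a region towards the origin, the first hyperplane that is met
  is a wall; the region behind it has one arc less.\<close>

lemma borders_remove_arc:
  fixes E :: "'v::finite set set"
  assumes "simple_graph E" "partial_orientation E P" "rho E P \<noteq> {}" "P \<noteq> {}"
  obtains a where "a \<in> P" "rho E (P - {a}) \<noteq> {}" "partial_orientation E (P - {a})"
    "borders (rho E (P - {a})) (rho E P)"
proof -
  have neq: "i \<noteq> j" if "(i, j) \<in> P" for i j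
    using partial_orientationD[OF assms(2) that] that by auto
  obtain x where x: "x \<in> rho E P" and inj: "inj_on (\<lambda>(i, j). x $ j - x $ i) P" (is "inj_on ?f P")
    using generic_point[OF open_rho assms(3)] neq by metis
  \<comment> \<open>The shortest arc length; by genericity only \<open>(i, j)\<close> attains it.
    Dividing \<open>x\<close> by \<open>m > 1\<close> puts it on the wall of \<open>(i, j)\<close>,
    keeps the other arcs longer than 1 and the blank edges shorter than 1.\<close>
  define m where "m = Min (?f ` P)"
  have "m \<in> ?f ` P" unfolding m_def using assms(4) by (intro Min_in) auto
  then obtain i j where ij: "(i, j) \<in> P" "m = x $ j - x $ i" by auto
  have m: "1 < m" using x ij by (fastforce simp: rho_iff)
  have "m < x $ l - x $ k" if "(k, l) \<in> P - {(i, j)}" for k l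
  proof -
    have "m \<le> ?f (k, l)" unfolding m_def using that by (intro Min_le) auto
    moreover have "?f (i, j) \<noteq> ?f (k, l)" using inj_onD[OF inj] that ij(1) by blast
    ultimately show ?thesis using ij by simp
  qed
  note big = this
  \<comment> \<open>The conditions of \<open>rho E P\<close> without the one for
    \<open>(i, j)\<close>. This open set contains \<open>y\<close> and extends across the
    wall.\<close>
  define W where "W = {y :: real ^ 'v. (\<forall>(k, l)\<in>P - {(i, j)}. y $ l > y $ k + 1) \<and>
     (\<forall>k l. {k, l} \<in> E \<longrightarrow> (k, l) \<notin> P \<longrightarrow> (l, k) \<notin> P \<longrightarrow> \<bar>y $ k - y $ l\<bar> < 1)}"
  have W_eq: "W = (\<Inter>(k, l)\<in>P - {(i, j)}. {y. y $ l > y $ k + 1}) \<inter>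
     (\<Inter>(k, l)\<in>{(k, l). {k, l} \<in> E \<and> (k, l) \<notin> P \<and> (l, k) \<notin> P}. {y. \<bar>y $ k - y $ l\<bar> < 1})"
    by (auto simp: W_def)
  have "open {y::real^'v. y $ l > y $ k + 1}" "open {y::real^'v. \<bar>y $ k - y $ l\<bar> < 1}" for k l
    by (intro open_Collect_less continuous_intros)+
  then have "open W"
    unfolding W_eq by (intro open_Int open_INT) auto
  define y where "y = (1 / m) *\<^sub>R x"
  have "y \<in> W"
  proof -
    have "y $ l > y $ k + 1" if "(k, l) \<in> P - {(i, j)}" for k l
    proof -
      have "m / m < (x $ l - x $ k) / m"
        using big[OF that] m by (intro divide_strict_right_mono) auto
      then show ?thesis using m by (simp add: y_def diff_divide_distrib)
    qed
    moreover have "\<bar>y $ k - y $ l\<bar> < 1" if "{k, l} \<in> E" "(k, l) \<notin> P" "(l, k) \<notin> P" for k l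
    proof -
      have "\<bar>x $ k - x $ l\<bar> < 1" using x that by (auto simp: rho_iff)
      moreover have "y $ k - y $ l = (x $ k - x $ l) / m"
        using m by (simp add: y_def field_simps)
      ultimately show ?thesis using m by (simp add: abs_divide)
    qed
    ultimately show ?thesis by (auto simp: W_def)
  qed
  have y1: "y $ j - y $ i = 1"
    using m ij(2) by (simp add: y_def field_simps)
  let ?P' = "P - {(i, j)}" and ?H = "{z. arc_normal i j \<bullet> z = 1}"
  \<comment> \<open>Shrinking \<open>y\<close> a little more stays in the open set \<open>W\<close>
    but makes the edge of \<open>(i, j)\<close> shorter than 1, which gives a point of the cell
    behind the wall.\<close>
  have "eventually (\<lambda>t. t *\<^sub>R y \<in> W) (at_left 1)"
  proof (rule topological_tendstoD[OF _ \<open>open W\<close>])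
    show "((\<lambda>t. t *\<^sub>R y) \<longlongrightarrow> 1 *\<^sub>R y) (at_left 1)" by (intro tendsto_intros)
  qed (use \<open>y \<in> W\<close> in simp)
  moreover have "eventually (\<lambda>t::real. 0 < t \<and> t < 1) (at_left 1)"
    by (auto simp: eventually_at_left[of 0 1] intro!: exI[of _ 0])
  ultimately have "eventually (\<lambda>t. t *\<^sub>R y \<in> W \<and> 0 < t \<and> t < 1) (at_left 1)"
    by (rule eventually_conj)
  then obtain t where t: "t *\<^sub>R y \<in> W" "0 < t" "t < 1"
    using eventually_happens'[OF trivial_limit_at_left_real] by blast
  have "\<bar>(t *\<^sub>R y) $ i - (t *\<^sub>R y) $ j\<bar> < 1"
  proof -
    have "(t *\<^sub>R y) $ i - (t *\<^sub>R y) $ j = - (t * (y $ j - y $ i))" by (simp add: algebra_simps)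
    also have "\<dots> = - t" using y1 by simp
    finally show ?thesis using t by simp
  qed
  with t(1) have "t *\<^sub>R y \<in> rho E ?P'"
    by (auto simp: W_def rho_iff)
  then have ne': "rho E ?P' \<noteq> {}" by blast
  have po': "partial_orientation E ?P'"
    using assms(2) by (auto simp: partial_orientation_def)
  have ji: "(j, i) \<notin> P" "{i, j} \<in> E" using partial_orientationD[OF assms(2) ij(1)] by auto
  \<comment> \<open>The closures differ only in the condition on the edge of \<open>(i, j)\<close>:
    length at least 1 in one, at most 1 in the other. On \<open>?H\<close> both hold.\<close>
  have eqF: "closure (rho E P) \<inter> ?H = closure (rho E ?P') \<inter> ?H"
    using ij(1) ji(1) by (fastforce simp: closure_rho assms(3) ne' abs_le_iff)
  let ?F = "closure (rho E P) \<inter> ?H"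
  \<comment> \<open>\<open>W\<close> meets the wall in a nonempty relatively open set, so the
    candidate facet containing it has the full dimension of the wall.\<close>
  have "aff_dim (W \<inter> ?H) = aff_dim ?H"
  proof (rule aff_dim_openin)
    show "openin (top_of_set ?H) (W \<inter> ?H)"
      using \<open>open W\<close> by (metis Int_commute openin_open)
  qed (use \<open>y \<in> W\<close> y1 affine_hyperplane[of "arc_normal i j" 1] in auto)
  moreover have "W \<inter> ?H \<subseteq> ?F"
  proof
    fix z assume z: "z \<in> W \<inter> ?H"
    have "z $ l \<ge> z $ k + 1" if "(k, l) \<in> P" for k l
    proof (cases "(k, l) = (i, j)")
      case False
      then have "z $ l > z $ k + 1" using z that by (fastforce simp: W_def)
      then show ?thesis by simp
    qed (use z in auto)
    moreover have "\<bar>z $ k - z $ l\<bar> \<le> 1" if "{k, l} \<in> E" "(k, l) \<notin> P" "(l, k) \<notin> P" for k l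
      using z that by (force simp: W_def)
    ultimately show "z \<in> ?F"
      using z by (auto simp: closure_rho assms(3))
  qed
  ultimately have "aff_dim ?F = aff_dim ?H"
    by (metis aff_dim_subset inf_le2 order_antisym)
  also have "\<dots> = int CARD('v) - 1"
    using arc_normal_nonzero[OF neq[OF ij(1)]] by (subst aff_dim_hyperplane) auto
  finally have dimF: "aff_dim ?F = int CARD('v) - 1" .
  have ne: "?F \<noteq> {}" using \<open>W \<inter> ?H \<subseteq> ?F\<close> \<open>y \<in> W\<close> y1 by auto
  have "?F face_of closure (rho E P)"
    by (rule face_of_Int_supporting_hyperplane_ge)
      (use ij(1) in \<open>fastforce intro: convex_closure convex_rho simp: closure_rho assms(3)\<close>)+
  moreover have "?F face_of closure (rho E ?P')"
    unfolding eqF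
    by (rule face_of_Int_supporting_hyperplane_le)
      (use ji in \<open>fastforce intro: convex_closure convex_rho simp: closure_rho ne'\<close>)+
  ultimately have "?F facet_of closure (rho E P)" "?F facet_of closure (rho E ?P')"
    using ne dimF by (auto simp: facet_of_def aff_dim_open open_rho assms(3) ne')
  moreover have "rho E ?P' \<noteq> rho E P"
    using tau_rho[OF assms(2,3)] tau_rho[OF po' ne'] ij(1) by force
  ultimately have "borders (rho E ?P') (rho E P)"
    by (auto simp: borders_def)
  with that ij(1) ne' po' show ?thesis by blast
qed

section \<open>The breadth-first labeling\<close>

lemma indeg_insert:
  fixes P :: "('v::finite \<times> 'v) set"
  assumes "(i, j) \<notin> P"
  shows "indeg (insert (i, j) P) w = indeg P w + (if w = j then 1 else 0)"
proof -
  have "{u. (u, w) \<in> insert (i, j) P} = {u. (u, w) \<in> P} \<union> (if w = j then {i} else {})"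
    by auto
  then show ?thesis
    using assms by (simp add: indeg_def)
qed

lemma psi_insert:
  fixes P :: "('v::finite \<times> 'v) set"
  assumes "(i, j) \<notin> P"
  shows "psi (insert (i, j) P) = (\<lambda>w. psi P w + (if w = j then 1 else 0))"
  using assms by (auto simp: psi_def indeg_insert)

text \<open>Plays the role of the graph distance to the central region: bordering regions differ by
  exactly one, and each noncentral region has a neighbour one step closer.\<close>

definition region_dist :: "'v::finite set set \<Rightarrow> (real ^ 'v) set \<Rightarrow> nat" where
  "region_dist E r = card (tau E r)"

lemma region_dist_0:
  assumes "simple_graph E" "r \<in> regions E" "region_dist E r = 0"
  shows "r = central_region E"
  using assms by (elim regionE) (auto simp: region_dist_def central_region_eq)

text \<open>Bordering regions differ by one arc, and the comparison of sizes decides that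
  \<open>r'\<close> is the one having it.\<close>

lemma outward_neighbour:
  assumes "simple_graph E" "r \<in> regions E" "r' \<in> regions E" "borders r r'"
    "region_dist E r \<le> region_dist E r'"
  obtains i j where "(i, j) \<notin> tau E r" "tau E r' = insert (i, j) (tau E r)"
    "\<forall>p. crosses r r' p \<longleftrightarrow> p = (i, j)" "region_dist E r' = Suc (region_dist E r)"
proof -
  obtain P where P: "r = rho E P" "partial_orientation E P" "rho E P \<noteq> {}" "tau E r = P"
    using regionE assms(1,2) .
  obtain P' where P': "r' = rho E P'" "partial_orientation E P'" "rho E P' \<noteq> {}" "tau E r' = P'"
    using regionE assms(1,3) .
  have "card P \<le> card P'" using assms(5) P P' by (simp add: region_dist_def)
  then obtain a where a: "a \<notin> P" "P' = insert a P"
    using borders_rho[OF assms(1) P(2,3) P'(2,3)] assms(4) P(1) P'(1)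
    by (metis card_insert_disjoint finite not_less_eq_eq order_refl)
  obtain i j where ij: "a = (i, j)" by fastforce
  have "crosses r r' p \<longleftrightarrow> p = (i, j)" for p
    using borders_insert_crosses[OF assms(1) P(3), of i j] a P' P assms(4) unfolding ij by auto
  with a that P P' ij show ?thesis
    by (auto simp: region_dist_def)
qed

lemma inward_neighbour:
  assumes "simple_graph E" "r \<in> regions E" "region_dist E r \<noteq> 0"
  obtains r' where "r' \<in> regions E" "borders r' r" "region_dist E r = Suc (region_dist E r')"
proof -
  obtain P where P: "r = rho E P" "partial_orientation E P" "rho E P \<noteq> {}" "tau E r = P"
    using regionE assms(1,2) .
  have "P \<noteq> {}" using assms(3) P by (auto simp: region_dist_def)
  then obtain a where a: "a \<in> P" "rho E (P - {a}) \<noteq> {}" "partial_orientation E (P - {a})"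
    "borders (rho E (P - {a})) (rho E P)"
    using borders_remove_arc assms(1) P(2,3) by metis
  show ?thesis
  proof
    show "rho E (P - {a}) \<in> regions E" using rho_in_regions assms(1) a(2,3) by blast
    show "borders (rho E (P - {a})) r" using a P by simp
    show "region_dist E r = Suc (region_dist E (rho E (P - {a})))"
      using P(4) tau_rho[OF a(3,2)] card_Suc_Diff1[OF finite a(1)] by (simp add: region_dist_def)
  qed
qed

text \<open>The queue is ordered by distance and spans at most two consecutive levels; neighbours of
  dequeued regions are labeled, and so is everything up to the level of the queue's head. The last
  point makes every newly labeled region lie further out. Its guard \<open>Q \<noteq> []\<close> is
  there because \<open>hd []\<close> is unspecified.\<close>

definition label_inv :: "'v::finite set set \<Rightarrow> 'v label_state \<Rightarrow> bool" where
  "label_inv E = (\<lambda>(Q, L). distinct Q \<and> set Q \<subseteq> dom L \<and> dom L \<subseteq> regions E \<and>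
     (\<forall>r\<in>dom L. L r = Some (psi (tau E r))) \<and>
     sorted (map (region_dist E) Q) \<and>
     (\<forall>q\<in>set Q. region_dist E q \<le> Suc (region_dist E (hd Q))) \<and>
     (\<forall>r\<in>dom L - set Q. \<forall>r'\<in>regions E. borders r r' \<longrightarrow> r' \<in> dom L) \<and>
     (Q \<noteq> [] \<longrightarrow> (\<forall>r\<in>regions E. region_dist E r \<le> region_dist E (hd Q) \<longrightarrow> r \<in> dom L)) \<and>
     central_region E \<in> dom L)"

lemma label_inv_init:
  assumes "simple_graph E"
  shows "label_inv E (label_init E)"
proof -
  have po: "partial_orientation E {}" by (simp add: partial_orientation_def)
  have "tau E (central_region E) = {}"
    using tau_rho[OF po central_region_nonempty] by (simp add: central_region_eq)
  moreover have "central_region E \<in> regions E"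
    using rho_in_regions[OF assms po central_region_nonempty] by (simp add: central_region_eq)
  moreover have "region_dist E r \<le> region_dist E (central_region E) \<Longrightarrow> r \<in> regions E \<Longrightarrow>
      r = central_region E" for r
    using region_dist_0[OF assms, of r] calculation(1) by (simp add: region_dist_def)
  ultimately show ?thesis
    by (simp add: label_inv_def label_init_def psi_def indeg_def)
qed

text \<open>All regions up to the level of the head \<open>r\<close> are labeled, so an unlabeled
  neighbour is farther away than \<open>r\<close> and has one additional arc.\<close>

lemma label_inv_unlabeled_neighbour:
  assumes "simple_graph E" "label_inv E (r # Q, L)" "r' \<in> unlabeled_neighbours E L r"
  obtains i j where "(i, j) \<notin> tau E r" "tau E r' = insert (i, j) (tau E r)"
    "\<forall>p. crosses r r' p \<longleftrightarrow> p = (i, j)" "region_dist E r' = Suc (region_dist E r)"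
proof -
  have "r \<in> regions E" "r' \<in> regions E" "borders r r'" "r' \<notin> dom L"
    using assms(2,3) by (auto simp: label_inv_def unlabeled_neighbours_def)
  moreover have "region_dist E r \<le> region_dist E r'"
    using assms(2) calculation by (force simp: label_inv_def)
  ultimately show ?thesis
    using outward_neighbour[OF assms(1)] that by metis
qed

text \<open>The crossing pair is the one new arc, so increasing the label at its head is the change
  from \<open>psi (tau E r)\<close> to \<open>psi (tau E r')\<close>.\<close>

lemma label_step_Cons:
  fixes enum :: "(real ^ 'v::finite) set set \<Rightarrow> (real ^ 'v) set list"
  assumes "simple_graph E" "\<forall>R. finite R \<longrightarrow> distinct (enum R) \<and> set (enum R) = R"
    and "label_inv E (r # Q, L)"
  obtains rs where "distinct rs" "set rs = unlabeled_neighbours E L r"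
    "label_step E enum (r # Q, L) =
       (Q @ rs, \<lambda>r'. if r' \<in> set rs then Some (psi (tau E r')) else L r')"
proof
  let ?rs = "enum (unlabeled_neighbours E L r)"
  have "finite (unlabeled_neighbours E L r)"
    by (rule finite_subset[OF _ finite_regions[OF assms(1)]]) (auto simp: unlabeled_neighbours_def)
  then show rs: "distinct ?rs" "set ?rs = unlabeled_neighbours E L r"
    using assms(2) by blast+
  have L: "L r = Some (psi (tau E r))"
    using assms(3) by (auto simp: label_inv_def)
  have "(let j = snd (THE p. crosses r r' p) in Some (\<lambda>w. the (L r) w + (if w = j then 1 else 0)))
      = Some (psi (tau E r'))" if r': "r' \<in> set ?rs" for r'
  proof -
    obtain i j where ij: "(i, j) \<notin> tau E r" "tau E r' = insert (i, j) (tau E r)"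
      "\<forall>p. crosses r r' p \<longleftrightarrow> p = (i, j)" "region_dist E r' = Suc (region_dist E r)"
      using label_inv_unlabeled_neighbour[OF assms(1,3) r'[unfolded rs(2)]] .
    then have "crosses r r' = (\<lambda>p. p = (i, j))" by (intro ext) blast
    then have "snd (THE p. crosses r r' p) = j" by simp
    with ij show ?thesis by (simp add: L psi_insert)
  qed
  then show "label_step E enum (r # Q, L) =
       (Q @ ?rs, \<lambda>r'. if r' \<in> set ?rs then Some (psi (tau E r')) else L r')"
    by (auto simp: label_step_def Let_def)
qed

lemma label_inv_step:
  fixes enum :: "(real ^ 'v::finite) set set \<Rightarrow> (real ^ 'v) set list"
  assumes "simple_graph E" "\<forall>R. finite R \<longrightarrow> distinct (enum R) \<and> set (enum R) = R"
    and "label_inv E (r # Q, L)"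
  shows "label_inv E (label_step E enum (r # Q, L))"
proof -
  obtain rs where rs: "distinct rs" "set rs = unlabeled_neighbours E L r"
    "label_step E enum (r # Q, L) =
       (Q @ rs, \<lambda>r'. if r' \<in> set rs then Some (psi (tau E r')) else L r')" (is "_ = (_, ?L)")
    using label_step_Cons[OF assms] .
  let ?d = "region_dist E"
  have inv: "distinct (r # Q)" "set (r # Q) \<subseteq> dom L" "dom L \<subseteq> regions E"
    "\<forall>r\<in>dom L. L r = Some (psi (tau E r))" "sorted (map ?d (r # Q))"
    "\<forall>q\<in>set (r # Q). ?d q \<le> Suc (?d (hd (r # Q)))"
    "\<forall>p\<in>dom L - set (r # Q). \<forall>r'\<in>regions E. borders p r' \<longrightarrow> r' \<in> dom L"
    "\<forall>p\<in>regions E. ?d p \<le> ?d r \<longrightarrow> p \<in> dom L" "central_region E \<in> dom L"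
    using assms(3) by (simp_all add: label_inv_def)
  have dom: "dom ?L = dom L \<union> set rs" by (auto split: if_splits)
  have rs_reg: "set rs \<subseteq> regions E" "set rs \<inter> dom L = {}"
    unfolding rs by (auto simp: unlabeled_neighbours_def)
  have drs: "?d q = Suc (?d r)" if "q \<in> set rs" for q
    using label_inv_unlabeled_neighbour[OF assms(1,3)] that rs(2) by metis
  have dQ: "?d r \<le> ?d q" "?d q \<le> Suc (?d r)" if "q \<in> set Q" for q
    using inv(5,6) that by auto
  have queue: "distinct (Q @ rs)" "sorted (map ?d (Q @ rs))"
  proof -
    show "distinct (Q @ rs)" using inv(1,2) rs_reg(2) rs(1) by auto
    have "sorted (map ?d xs)" if "\<forall>q\<in>set xs. ?d q = Suc (?d r)" for xs
      using that by (induction xs) auto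
    then have "sorted (map ?d rs)" using drs by blast
    moreover have "sorted (map ?d Q)" using inv(5) by simp
    ultimately show "sorted (map ?d (Q @ rs))"
      using drs dQ(2) by (simp add: sorted_append)
  qed
  have hd_le: "?d r \<le> ?d (hd (Q @ rs))" if "Q @ rs \<noteq> []"
  proof -
    have "hd (Q @ rs) \<in> set Q \<union> set rs" using hd_in_set[OF that] by simp
    then show ?thesis using dQ drs by force
  qed
  have processed: "r' \<in> dom ?L"
    if "p \<in> dom ?L - set (Q @ rs)" "r' \<in> regions E" "borders p r'" for p r'
  proof (cases "p = r")
    case True
    then show ?thesis
      using that rs(2) unfolding dom by (auto simp: unlabeled_neighbours_def)
  next
    case False
    then have "p \<in> dom L - set (r # Q)" using that unfolding dom by auto
    then show ?thesis using inv(7) that(2,3) unfolding dom by blast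
  qed
  have level: "s \<in> dom ?L"
    if ne: "Q @ rs \<noteq> []" and s: "s \<in> regions E" "?d s \<le> ?d (hd (Q @ rs))" for s
  proof (cases "?d s \<le> ?d r")
    case True
    then show ?thesis using inv(8) s(1) unfolding dom by blast
  next
    case False
    have "hd (Q @ rs) \<in> set Q \<union> set rs" using hd_in_set[OF ne] by simp
    then have "?d (hd (Q @ rs)) \<le> Suc (?d r)"
      using dQ(2) drs by (metis Un_iff order_refl)
    \<comment> \<open>The remaining case: the old level is exhausted and \<open>s\<close> lies on
      the next one. Its inward neighbour \<open>p\<close> is on the old level, hence labeled and no
      longer queued, so its neighbour \<open>s\<close> has been labeled.\<close>
    then have ds: "?d s = Suc (?d r)" "?d (hd (Q @ rs)) = Suc (?d r)"
      using s(2) False by linarith+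
    then have nz: "?d s \<noteq> 0" by simp
    obtain p where p: "p \<in> regions E" "borders p s" "?d s = Suc (?d p)"
      using inward_neighbour[OF assms(1) s(1) nz] .
    have "\<forall>q\<in>set (Q @ rs). ?d (hd (Q @ rs)) \<le> ?d q"
      using queue(2) ne by (cases "Q @ rs") auto
    then have "p \<notin> set (Q @ rs)" using ds p(3) by force
    moreover have "p \<in> dom L" using inv(8) p ds by simp
    ultimately show ?thesis using processed[of p s] p(2) s(1) unfolding dom by blast
  qed
  have bound: "?d q \<le> Suc (?d (hd (Q @ rs)))" if "q \<in> set (Q @ rs)" for q
  proof -
    have "?d r \<le> ?d (hd (Q @ rs))" using that hd_le by (cases "Q @ rs") auto
    moreover have "?d q \<le> Suc (?d r)" using that dQ drs by force
    ultimately show ?thesis by simp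
  qed
  have labels: "?L p = Some (psi (tau E p))" if "p \<in> dom ?L" for p
    using inv(4) that by (auto split: if_splits)
  show ?thesis
    unfolding rs(3) label_inv_def prod.case
  proof (intro conjI)
    show "set (Q @ rs) \<subseteq> dom ?L" "dom ?L \<subseteq> regions E" "central_region E \<in> dom ?L"
      using inv(2,3,9) rs_reg unfolding dom by auto
  qed (use queue bound processed level labels in blast)+
qed

text \<open>Provides the invariant in every state of a run, where the uniqueness of the crossing
  pair is to be shown. With an empty queue a step changes nothing, so every \<open>k\<close> is
  covered.\<close>

lemma label_inv_funpow:
  fixes enum :: "(real ^ 'v::finite) set set \<Rightarrow> (real ^ 'v) set list"
  assumes "simple_graph E" "\<forall>R. finite R \<longrightarrow> distinct (enum R) \<and> set (enum R) = R"
  shows "label_inv E ((label_step E enum ^^ k) (label_init E))"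
proof (induction k)
  case (Suc k)
  obtain Q L where QL: "(label_step E enum ^^ k) (label_init E) = (Q, L)" by fastforce
  show ?case
  proof (cases Q)
    case Nil
    then have "label_step E enum (Q, L) = (Q, L)" by (simp add: label_step_def)
    then show ?thesis using Suc by (simp add: QL)
  next
    case (Cons r Q')
    then show ?thesis using label_inv_step[OF assms] Suc unfolding QL by (simp add: QL)
  qed
qed (use label_inv_init assms in simp)

text \<open>Induction on the distance: the inward neighbour is labeled and, the queue being empty,
  already processed, so all its neighbours are labeled.\<close>

lemma label_inv_final:
  assumes "simple_graph E" "label_inv E ([], L)"
  shows "dom L = regions E"
proof
  show "regions E \<subseteq> dom L"
  proof
    fix r assume "r \<in> regions E"
    then show "r \<in> dom L"
    proof (induction "region_dist E r" arbitrary: r)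
      case 0
      then show ?case
        using region_dist_0[OF assms(1)] assms(2) by (auto simp: label_inv_def)
    next
      case (Suc m)
      then obtain r' where "r' \<in> regions E" "borders r' r" "region_dist E r = Suc (region_dist E r')"
        using inward_neighbour[OF assms(1), of r] by (metis nat.distinct(1))
      then show ?case
        using Suc assms(2) by (auto simp: label_inv_def)
    qed
  qed
qed (use assms(2) in \<open>simp add: label_inv_def\<close>)

lemma label_run_terminates:
  fixes enum :: "(real ^ 'v::finite) set set \<Rightarrow> (real ^ 'v) set list"
  assumes "simple_graph E" "\<forall>R. finite R \<longrightarrow> distinct (enum R) \<and> set (enum R) = R"
  obtains L where "label_run E enum = Some ([], L)" "dom L = regions E"
    "\<And>r. r \<in> regions E \<Longrightarrow> L r = Some (psi (tau E r))"
proof -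
  let ?b = "\<lambda>(Q, L). Q \<noteq> []"
  \<comment> \<open>A step removes one region from the queue and moves \<open>rs\<close> from the
    unlabeled regions to the queue, so this sum drops by one.\<close>
  let ?f = "\<lambda>(Q, L). card (regions E - dom L) + length Q"
  have step: "label_inv E (label_step E enum s) \<and> ?f (label_step E enum s) < ?f s"
    if inv: "label_inv E s" and "?b s" for s
  proof -
    obtain r Q L where s: "s = (r # Q, L)"
      using \<open>?b s\<close> by (cases s) (auto simp: neq_Nil_conv)
    obtain rs where rs: "distinct rs" "set rs = unlabeled_neighbours E L r"
      "label_step E enum s = (Q @ rs, \<lambda>r'. if r' \<in> set rs then Some (psi (tau E r')) else L r')"
      using label_step_Cons[OF assms inv[unfolded s]] unfolding s .
    have "dom (\<lambda>r'. if r' \<in> set rs then Some (psi (tau E r')) else L r') = dom L \<union> set rs"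
      by (auto split: if_splits)
    moreover have "card (regions E - dom L) = card (regions E - (dom L \<union> set rs)) + length rs"
    proof -
      have "set rs \<subseteq> regions E - dom L"
        unfolding rs by (auto simp: unlabeled_neighbours_def)
      moreover have "regions E - (dom L \<union> set rs) = (regions E - dom L) - set rs" by blast
      ultimately show ?thesis
        using finite_regions[OF assms(1)] distinct_card[OF rs(1)]
        by (metis List.finite_set card_Diff_subset card_mono finite_Diff le_add_diff_inverse2)
    qed
    ultimately have "?f (label_step E enum s) < ?f s"
      unfolding rs(3) by (simp add: s)
    then show ?thesis
      using label_inv_step[OF assms] inv unfolding s by blast
  qed
  obtain t where t: "label_run E enum = Some t"
    using measure_while_option_Some[of "label_inv E" ?b "label_step E enum" ?f, OF step label_inv_init[OF assms(1)]]
    by (auto simp: label_run_def)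
  have "label_inv E t"
    by (rule while_option_rule[where P = "label_inv E", OF conjunct1[OF step]
          t[unfolded label_run_def] label_inv_init[OF assms(1)]])
  moreover obtain L where tL: "t = ([], L)"
    using while_option_stop[OF t[unfolded label_run_def]] by (cases t) auto
  ultimately have inv: "label_inv E ([], L)" by simp
  then have "dom L = regions E" by (rule label_inv_final[OF assms(1)])
  moreover have "L r = Some (psi (tau E r))" if "r \<in> dom L" for r
    using inv that by (auto simp: label_inv_def)
  ultimately show ?thesis
    using that t tL by blast
qed

section \<open>Quasi-superstable divisors\<close>

definition neighbours :: "'v set set \<Rightarrow> 'v \<Rightarrow> 'v set" where
  "neighbours E u = {w. {u, w} \<in> E}"

lemma cone_graph_Some_Some: "{Some u, Some w} \<in> cone_graph E \<longleftrightarrow> {u, w} \<in> E"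
proof -
  have "{Some u, Some w} = Some ` {u, w}" by simp
  then have "{Some u, Some w} \<in> (\<lambda>e. Some ` e) ` E \<longleftrightarrow> {u, w} \<in> E"
    by (metis (no_types, lifting) image_iff inj_Some inj_image_eq_iff)
  moreover have "{Some u, Some w} \<noteq> {Some x, None}" for x
    by (auto simp: doubleton_eq_iff)
  ultimately show ?thesis by (auto simp: cone_graph_def)
qed

lemma cone_graph_Some_None: "{Some u, None} \<in> cone_graph E"
  by (auto simp: cone_graph_def)

lemma simple_graph_edgeE:
  assumes "simple_graph E" "e \<in> E" "u \<in> e"
  obtains w where "e = {u, w}" "w \<noteq> u"
proof -
  obtain x y where "e = {x, y}" "x \<noteq> y"
    using assms by (auto simp: simple_graph_def card_2_iff)
  then show ?thesis using that[of x] that[of y] assms(3) by auto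
qed

lemma degree_cone_graph:
  fixes E :: "'v::finite set set"
  assumes "simple_graph E"
  shows "degree (cone_graph E) (Some u) = Suc (card (neighbours E u))"
proof -
  have "{e \<in> cone_graph E. Some u \<in> e} =
      insert {Some u, None} ((\<lambda>w. {Some u, Some w}) ` neighbours E u)" (is "?L = ?R")
  proof
    show "?R \<subseteq> ?L"
      by (auto simp: neighbours_def cone_graph_Some_Some cone_graph_Some_None)
    show "?L \<subseteq> ?R"
    proof
      fix e assume "e \<in> ?L"
      then consider f where "f \<in> E" "e = Some ` f" "u \<in> f" | x where "e = {Some x, None}" "x = u"
        by (auto simp: cone_graph_def)
      then show "e \<in> ?R"
      proof cases
        case 1
        then obtain w where "f = {u, w}" using simple_graph_edgeE[OF assms] by metis
        with 1 show ?thesis by (auto simp: neighbours_def)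
      qed simp
    qed
  qed
  moreover have "{Some u, None} \<notin> (\<lambda>w. {Some u, Some w}) ` neighbours E u"
    by (auto simp: doubleton_eq_iff)
  moreover have "inj_on (\<lambda>w. {Some u, Some w}) (neighbours E u)"
    by (auto simp: inj_on_def doubleton_eq_iff)
  ultimately show ?thesis
    by (simp add: degree_def card_image)
qed

lemma sum_laplacian_cone_graph:
  fixes E :: "'v::finite set set"
  assumes "simple_graph E"
  shows "(\<Sum>w \<in> UNIV - {None}. laplacian (cone_graph E) (Some u) w * (if w \<in> Some ` X then 1 else 0))
     = (if u \<in> X then 1 + int (card (neighbours E u)) else 0) - int (card (neighbours E u \<inter> X))"
proof -
  have "(\<Sum>w \<in> UNIV - {None}. laplacian (cone_graph E) (Some u) w * (if w \<in> Some ` X then 1 else 0))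
     = (\<Sum>w \<in> UNIV. laplacian (cone_graph E) (Some u) (Some w) * (if w \<in> X then 1 else 0))"
    by (rule sum.reindex_cong[of Some]) (auto simp: UNIV_option_conv)
  also have "\<dots> = (\<Sum>w \<in> X. laplacian (cone_graph E) (Some u) (Some w))"
    by (simp add: if_distrib sum.If_cases)
  also have "\<dots> = (\<Sum>w \<in> X. if u = w then 1 + int (card (neighbours E u)) else 0)
       - (\<Sum>w \<in> X. if {u, w} \<in> E then 1 else 0)"
    by (simp add: laplacian_def cone_graph_Some_Some degree_cone_graph[OF assms] sum_subtractf cong: if_cong)
  also have "(\<Sum>w \<in> X. if {u, w} \<in> E then 1 else 0 :: int) = int (card (neighbours E u \<inter> X))"
    by (simp add: sum.If_cases neighbours_def Int_commute)
  finally show ?thesis by simp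
qed

text \<open>The chip added by the shift pays for the edge to the sink: firing \<open>X\<close> from
  \<open>c + 1\<close> leaves a vertex \<open>u\<close> of \<open>X\<close> nonnegative exactly when
  \<open>c u\<close> covers its neighbours outside \<open>X\<close>, and vertices outside
  \<open>X\<close> only gain chips. This is the parking-function form of superstability.\<close>

lemma quasi_superstable_iff:
  fixes E :: "'v::finite set set"
  assumes "simple_graph E"
  shows "c \<in> quasi_superstable E \<longleftrightarrow> (\<forall>u. 0 \<le> c u + 1) \<and>
     (\<forall>X. X \<noteq> {} \<longrightarrow> (\<exists>u\<in>X. c u < int (card (neighbours E u - X))))"
proof -
  have card: "int (card (neighbours E u)) = int (card (neighbours E u - X)) + int (card (neighbours E u \<inter> X))" for u X
    by (metis Int_Diff_disjoint Int_Diff_Un add.commute card_Un_disjoint finite of_nat_add)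
  have legal: "(\<forall>u. u \<noteq> None \<longrightarrow> 0 \<le> case_option 0 (\<lambda>u. c u + 1) u - (\<Sum>w \<in> UNIV - {None}.
         laplacian (cone_graph E) u w * (if w \<in> Some ` X then 1 else 0)))
      \<longleftrightarrow> (\<forall>u\<in>X. int (card (neighbours E u - X)) \<le> c u)" (is "?A \<longleftrightarrow> ?B")
    if "\<forall>u. 0 \<le> c u + 1" for X
  proof -
    have "0 \<le> c u + 1 - ((if u \<in> X then 1 + int (card (neighbours E u)) else 0) - int (card (neighbours E u \<inter> X)))
        \<longleftrightarrow> (u \<in> X \<longrightarrow> int (card (neighbours E u - X)) \<le> c u)" for u
    proof (cases "u \<in> X")
      case False
      have "0 \<le> c u + 1" using \<open>\<forall>u. 0 \<le> c u + 1\<close> by blast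
      with False show ?thesis by simp
    qed (use card[of u X] in auto)
    then show ?thesis
      by (simp add: sum_laplacian_cone_graph[OF assms] split_option_all Ball_def)
  qed
  have sets: "(\<exists>X. X \<noteq> {} \<and> None \<notin> X \<and> Q X) \<longleftrightarrow> (\<exists>Y. Y \<noteq> {} \<and> Q (Some ` Y))" for Q :: "'v option set \<Rightarrow> bool"
  proof
    assume "\<exists>X. X \<noteq> {} \<and> None \<notin> X \<and> Q X"
    then obtain X where X: "X \<noteq> {}" "None \<notin> X" "Q X" by blast
    have "X = Some ` (Some -` X)" using X(2) by (auto simp: image_iff) (metis not_None_eq)
    with X show "\<exists>Y. Y \<noteq> {} \<and> Q (Some ` Y)" by (metis image_empty)
  qed (metis image_iff image_is_empty option.distinct(1))
  have nonneg: "(\<forall>u. u \<noteq> None \<longrightarrow> 0 \<le> case_option 0 (\<lambda>u. c u + 1) u) \<longleftrightarrow> (\<forall>u. 0 \<le> c u + 1)"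
    by (auto split: option.split)
  show ?thesis
    unfolding quasi_superstable_def superstable_def mem_Collect_eq sets nonneg
    using legal by (meson linorder_not_le)
qed

lemma psi_tau_quasi_superstable:
  fixes E :: "'v::finite set set"
  assumes "simple_graph E" "r \<in> regions E"
  shows "psi (tau E r) \<in> quasi_superstable E"
proof -
  obtain P where P: "r = rho E P" "partial_orientation E P" "rho E P \<noteq> {}" "tau E r = P"
    using regionE assms .
  obtain x where x: "x \<in> rho E P" using P(3) by blast
  have "\<exists>u\<in>X. psi P u < int (card (neighbours E u - X))" if "X \<noteq> {}" for X
  proof -
    obtain u where u: "u \<in> X" "\<And>w. w \<in> X \<Longrightarrow> x $ u \<le> x $ w"
    proof -
      have "Min ((\<lambda>w. x $ w) ` X) \<in> (\<lambda>w. x $ w) ` X"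
        using \<open>X \<noteq> {}\<close> by (intro Min_in) auto
      then obtain u where "u \<in> X" "x $ u = Min ((\<lambda>w. x $ w) ` X)" by auto
      then show ?thesis using that[of u] by simp
    qed
    \<comment> \<open>In-neighbours have strictly smaller coordinates than the minimum over
      \<open>X\<close>. This bounds the indegree only weakly; the -1 in \<open>psi\<close> makes the
      inequality strict.\<close>
    have "{w. (w, u) \<in> P} \<subseteq> neighbours E u - X"
    proof
      fix w assume "w \<in> {w. (w, u) \<in> P}"
      then have "{w, u} \<in> E" "x $ u > x $ w + 1"
        using x partial_orientationD(1)[OF P(2)] by (auto simp: rho_iff)
      with u(2)[of w] show "w \<in> neighbours E u - X"
        by (auto simp: neighbours_def insert_commute)
    qed
    then have "indeg P u \<le> card (neighbours E u - X)"
      unfolding indeg_def by (intro card_mono) auto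
    then show ?thesis using u(1) by (intro bexI[of _ u]) (auto simp: psi_def)
  qed
  then show ?thesis
    unfolding quasi_superstable_iff[OF assms(1)] P(4) by (auto simp: psi_def)
qed

section \<open>Semiorientations from points\<close>

lemma cycle_arcs_Cons:
  "cycle_arcs (w # ws) = set (zip (w # ws) (ws @ [w]))"
  by (simp add: cycle_arcs_def)

text \<open>Telescoping around a closed walk: heads and tails of the arcs run through the same list
  up to rotation.\<close>

lemma sum_cycle_arcs:
  fixes f :: "'v \<Rightarrow> real"
  assumes "distinct ws"
  shows "(\<Sum>(u, w)\<in>cycle_arcs ws. f w - f u) = 0"
proof -
  let ?z = "zip ws (rotate1 ws)"
  have "(\<Sum>(u, w)\<in>cycle_arcs ws. f w - f u) = sum_list (map (\<lambda>(u, w). f w - f u) ?z)"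
    unfolding cycle_arcs_def
    using assms by (intro sum.distinct_set_conv_list distinct_zipI1)
  also have "\<dots> = sum_list (map (\<lambda>p. f (snd p)) ?z) - sum_list (map (\<lambda>p. f (fst p)) ?z)"
  proof -
    have "(\<lambda>(u, w). f w - f u) = (\<lambda>p. f (snd p) - f (fst p))" by auto
    then show ?thesis by (simp only: sum_list_subtractf)
  qed
  also have "map (\<lambda>p. f (snd p)) ?z = map f (rotate1 ws)"
    using map_snd_zip[of ws "rotate1 ws"] by (metis (no_types, lifting) comp_apply length_rotate1 map_eq_conv map_map)
  also have "map (\<lambda>p. f (fst p)) ?z = map f ws"
    using map_fst_zip[of ws "rotate1 ws"] by (metis (no_types, lifting) comp_apply length_rotate1 map_eq_conv map_map)
  also have "sum_list (map f (rotate1 ws)) = sum_list (map f ws)"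
    by (cases ws) auto
  finally show ?thesis by simp
qed

text \<open>Coordinate differences sum to 0 around a cycle. Along the traversal an oriented edge
  contributes more than 1 and a blank edge more than -1, so blank edges must be in the
  majority.\<close>

lemma semiorientation_of_rho:
  fixes E :: "'v::finite set set"
  assumes "partial_orientation E P" "rho E P \<noteq> {}"
  shows "P \<in> semiorientations E"
proof -
  obtain x where x: "x \<in> rho E P" using assms(2) by blast
  have "card (cycle_edges ws \<inter> oriented_edges P) < card (cycle_edges ws \<inter> blank_edges E P)"
    if cycle: "potential_cycle E P ws" for ws
  proof -
    obtain P' where ws: "3 \<le> length ws" "distinct ws" "cycle_edges ws \<subseteq> E"
      and P': "partial_orientation E P'" "P \<subseteq> P'" "cycle_arcs ws \<subseteq> P'"
      using cycle by (auto simp: potential_cycle_def graph_cycle_def)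
    let ?A = "cycle_arcs ws" and ?e = "\<lambda>(u, w). {u, w}"
    have edges: "cycle_edges ws = ?e ` ?A"
      by (auto simp: cycle_edges_def)
    \<comment> \<open>The completion \<open>P'\<close> is antisymmetric and contains both
      \<open>P\<close> and the arcs of the cycle. Hence oriented edges agree with the traversal, and
      distinct arcs have distinct edges, so arcs may be counted in place of edges.\<close>
    have rev: "(w, u) \<notin> P" if "(u, w) \<in> ?A" for u w
      using that P'(2,3) partial_orientationD(2)[OF P'(1)] by blast
    have inj: "inj_on ?e ?A"
    proof (rule inj_onI; clarify)
      fix a b u w assume *: "(a, b) \<in> ?A" "(u, w) \<in> ?A" "{a, b} = {u, w}"
      then have "(u, w) \<in> P'" "(a, b) \<in> P'" using P'(3) by auto
      then show "a = u \<and> b = w"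
        using *(3) partial_orientationD(2)[OF P'(1)] by (auto simp: doubleton_eq_iff)
    qed
    have or: "?e a \<in> oriented_edges P \<longleftrightarrow> a \<in> P" if "a \<in> ?A" for a
      using that rev by (cases a) (auto simp: oriented_edges_def doubleton_eq_iff)
    have "cycle_edges ws \<inter> oriented_edges P = ?e ` (?A \<inter> P)"
      using or unfolding edges by blast
    then have c1: "card (cycle_edges ws \<inter> oriented_edges P) = card (?A \<inter> P)"
      using inj by (metis card_image inf_le1 inj_on_subset)
    have "cycle_edges ws \<inter> blank_edges E P = ?e ` (?A - P)"
      using or ws(3) unfolding edges blank_edges_def by blast
    then have c2: "card (cycle_edges ws \<inter> blank_edges E P) = card (?A - P)"
      using inj by (metis card_image Diff_subset inj_on_subset)
    have "0 = (\<Sum>(u, w)\<in>?A. x $ w - x $ u)"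
      using sum_cycle_arcs[OF ws(2)] by simp
    also have "\<dots> > (\<Sum>a\<in>?A. if a \<in> P then 1 else - 1)"
    proof (rule sum_strict_mono)
      show "?A \<noteq> {}" using ws(1) by (cases ws) (auto simp: cycle_arcs_Cons)
      fix a assume a: "a \<in> ?A"
      obtain u w where uw: "a = (u, w)" by fastforce
      show "(if a \<in> P then 1 else - 1) < (case a of (u, w) \<Rightarrow> x $ w - x $ u)"
      proof (cases "a \<in> P")
        case True
        then show ?thesis using x uw by (auto simp: rho_iff)
      next
        case False
        have "{u, w} \<in> E" using a uw edges ws(3) by auto
        moreover have "(w, u) \<notin> P" using a uw rev by simp
        ultimately have "\<bar>x $ u - x $ w\<bar> < 1" using x False uw by (auto simp: rho_iff)
        then show ?thesis using False uw by (simp add: abs_less_iff)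
      qed
    qed simp
    also have "(\<Sum>a\<in>?A. if a \<in> P then 1 else - 1) = real (card (?A \<inter> P)) - real (card (?A - P))"
      by (simp add: sum.If_cases Diff_eq)
    finally show ?thesis by (simp add: c1 c2)
  qed
  with assms(1) show ?thesis by (simp add: semiorientations_def)
qed

section \<open>The firing algorithm\<close>

lemma finite_sets_separated:
  fixes A B :: "real set"
  assumes "finite A" "finite B" "\<And>a b. a \<in> A \<Longrightarrow> b \<in> B \<Longrightarrow> a < b"
  obtains y where "\<And>a. a \<in> A \<Longrightarrow> a < y" "\<And>b. b \<in> B \<Longrightarrow> y < b"
proof (cases "A = {} \<or> B = {}")
  case True
  then show ?thesis
  proof
    assume "A = {}"
    moreover obtain y where "\<forall>b\<in>B. y < b"
      using assms(2) by (metis Min_le lt_ex order_less_le_trans)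
    ultimately show ?thesis using that by blast
  next
    assume "B = {}"
    moreover obtain y where "\<forall>a\<in>A. a < y"
      using assms(1) by (metis Max_ge gt_ex order_le_less_trans)
    ultimately show ?thesis using that by blast
  qed
next
  case False
  then have "Max A < Min B" using assms by simp
  then obtain y where "Max A < y" "y < Min B" using dense by blast
  then have "\<forall>a\<in>A. a < y" "\<forall>b\<in>B. y < b" using assms(1,2) False by simp_all
  then show ?thesis using that by blast
qed

text \<open>Positions on a line realizing an interval order without nested intervals: item \<open>k\<close> occupies
  the time interval from \<open>f k\<close> to \<open>k\<close>.\<close>

lemma unit_interval_realization:
  fixes f :: "nat \<Rightarrow> nat"
  assumes "\<And>k. k < N \<Longrightarrow> f k \<le> k" "\<And>i k. i \<le> k \<Longrightarrow> k < N \<Longrightarrow> f i \<le> f k"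
  shows "\<exists>X :: nat \<Rightarrow> real. \<forall>k < N. \<forall>i < k. X i < X k \<and> (i < f k \<longrightarrow> X i + 1 < X k) \<and> (f k \<le> i \<longrightarrow> X k < X i + 1)"
  using assms
proof (induction N)
  case (Suc N)
  then obtain X :: "nat \<Rightarrow> real" where X:
    "\<And>i k. i < k \<Longrightarrow> k < N \<Longrightarrow> X i < X k \<and> (i < f k \<longrightarrow> X i + 1 < X k) \<and> (f k \<le> i \<longrightarrow> X k < X i + 1)"
    by (metis less_Suc_eq)
  have le: "X i \<le> X k" if "i \<le> k" "k < N" for i k
    using X[of i k] that by (cases "i = k") auto
  obtain y where y: "\<forall>i < N. X i < y \<and> (i < f N \<longrightarrow> X i + 1 < y) \<and> (f N \<le> i \<longrightarrow> y < X i + 1)"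
  proof -
    \<comment> \<open>The lower and upper bounds that the position of item \<open>N\<close> must
      satisfy.\<close>
    let ?A = "X ` {..<N} \<union> (\<lambda>i. X i + 1) ` {i. i < f N}" and ?B = "(\<lambda>i. X i + 1) ` {i. f N \<le> i \<and> i < N}"
    have "a < b" if ab: "a \<in> ?A" "b \<in> ?B" for a b
    proof -
      obtain j where j: "f N \<le> j" "j < N" "b = X j + 1" using ab(2) by auto
      have *: "X i < X j + 1" if "i < N" for i
      proof (cases "i \<le> j")
        case True
        then show ?thesis using le[of i j] j(2) by simp
      next
        case False
        \<comment> \<open>Here the absence of nesting enters: \<open>f i \<le> f N \<le> j\<close>
          means that \<open>j\<close> still overlaps \<open>i\<close>, so
          \<open>X i < X j + 1\<close>.\<close>
        have "f i \<le> f N" using Suc.prems(2)[of i N] that by simp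
        then show ?thesis using X[of j i] False that j(1) by simp
      qed
      have "X i + 1 < X j + 1" if "i < f N" for i
        using X[of i j] j that by simp
      with * show ?thesis using ab(1) j(3) by auto
    qed
    moreover have "finite ?A" "finite ?B" by auto
    ultimately obtain y where "\<forall>a\<in>?A. a < y" "\<forall>b\<in>?B. y < b"
      using finite_sets_separated by (metis (no_types, lifting))
    then show ?thesis using that by force
  qed
  show ?case
    by (rule exI[of _ "X(N := y)"]) (use X y in \<open>auto simp: less_Suc_eq\<close>)
qed simp

text \<open>For \<open>h\<close> the firing order and \<open>q u\<close> the number of firings until
  \<open>u\<close> becomes unstable, this is the orientation built by the algorithm. The firing that
  makes \<open>u\<close> unstable has index \<open>q u - 1\<close>, so its arc is included.\<close>

definition arcs_before :: "'v set set \<Rightarrow> 'v list \<Rightarrow> ('v \<Rightarrow> nat) \<Rightarrow> ('v \<times> 'v) set" where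
  "arcs_before E h q = {(h ! k, u) | k u. k < q u \<and> {h ! k, u} \<in> E}"

lemma arcs_before_into:
  "q u = length h \<Longrightarrow> {a. (a, u) \<in> arcs_before E h q} = neighbours E u \<inter> set h"
  by (fastforce simp: arcs_before_def neighbours_def in_set_conv_nth insert_commute)

lemma neighbours_Int_append:
  "neighbours E u \<inter> set (h @ [w]) = (if {u, w} \<in> E then insert w else id) (neighbours E u \<inter> set h)"
  by (auto simp: neighbours_def)

text \<open>Here \<open>h\<close> lists the vertices fired so far and \<open>q u\<close> counts the firings that precede the
  moment at which \<open>u\<close> became unstable (all firings so far, if \<open>u\<close> has not become unstable yet).\<close>

definition firing_inv ::
    "'v::finite set set \<Rightarrow> ('v \<Rightarrow> int) \<Rightarrow> 'v list \<Rightarrow> ('v \<Rightarrow> nat) \<Rightarrow> 'v firing_state \<Rightarrow> bool" where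
  "firing_inv E c h q = (\<lambda>(Q, F, b, P, B). F = set h \<and> distinct (h @ Q) \<and>
     (\<forall>u. b u = (if u \<in> set h then 0 else 1 + int (card (neighbours E u)))
        - (c u + 1) + int (card (neighbours E u \<inter> set h))) \<and>
     set Q = {u. u \<notin> set h \<and> c u + 1 \<le> int (card (neighbours E u \<inter> set h))} \<and>
     P = arcs_before E h q \<and>
     (\<forall>u\<in>set (h @ Q). int (indeg P u) = c u + 1) \<and>
     (\<forall>u. u \<notin> set (h @ Q) \<longrightarrow> q u = length h) \<and>
     (\<forall>k<length (h @ Q). q ((h @ Q) ! k) \<le> k \<and> q ((h @ Q) ! k) \<le> length h) \<and>
     sorted (map q (h @ Q)) \<and>
     (\<forall>e\<in>B. e \<inter> set h \<noteq> {}) \<and>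
     (\<forall>u\<in>set h. \<forall>w. {u, w} \<in> E \<longrightarrow> (u, w) \<in> P \<or> (w, u) \<in> P \<or> {u, w} \<in> B))"

lemma firing_inv_init:
  fixes E :: "'v::finite set set"
  assumes "simple_graph E" "\<And>u. 0 \<le> c u + 1" "distinct vs" "set vs = UNIV"
  shows "firing_inv E c [] (\<lambda>_. 0) (eta_init E vs c)"
proof -
  have c: "c u + 1 = 0" if "c u + 1 \<le> 0" for u
    using assms(2)[of u] that by simp
  have sorted0: "sorted (map (\<lambda>_. 0::nat) xs)" for xs :: "'v list"
    by (induction xs) auto
  show ?thesis
    using assms(3,4) c sorted0
    by (auto simp: firing_inv_def eta_init_def unstable_def degree_cone_graph[OF assms(1)]
        Let_def arcs_before_def indeg_def)
qed

text \<open>Vertices outside fired list and queue get the new count \<open>Suc (length h)\<close>: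
  for those just made unstable it becomes final, for the others it still equals the number of
  firings.\<close>

lemma firing_inv_step:
  fixes E :: "'v::finite set set"
  assumes "simple_graph E" "distinct vs" "set vs = UNIV"
    and inv: "firing_inv E c h q (w # Q, F, b, P, B)"
  defines "q' \<equiv> \<lambda>u. if u \<in> set (h @ w # Q) then q u else Suc (length h)"
  shows "firing_inv E c (h @ [w]) q' (eta_step E vs (w # Q, F, b, P, B))"
proof -
  let ?l = "h @ w # Q" and ?h = "h @ [w]"
  let ?cn = "\<lambda>h u. int (card (neighbours E u \<inter> set h))"
  have F: "F = set h" and dist: "distinct ?l"
    and b: "\<And>u. b u = (if u \<in> set h then 0 else 1 + int (card (neighbours E u))) - (c u + 1) + ?cn h u"
    and Q: "set (w # Q) = {u. u \<notin> set h \<and> c u + 1 \<le> ?cn h u}"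
    and P: "P = arcs_before E h q"
    and indeg: "\<And>u. u \<in> set ?l \<Longrightarrow> int (indeg P u) = c u + 1"
    and q_out: "\<And>u. u \<notin> set ?l \<Longrightarrow> q u = length h"
    and q_le: "\<And>k. k < length ?l \<Longrightarrow> q (?l ! k) \<le> k \<and> q (?l ! k) \<le> length h"
    and q_sorted: "sorted (map q ?l)"
    and B: "\<And>e. e \<in> B \<Longrightarrow> e \<inter> set h \<noteq> {}"
    and handled: "\<And>u a. u \<in> set h \<Longrightarrow> {u, a} \<in> E \<Longrightarrow> (u, a) \<in> P \<or> (a, u) \<in> P \<or> {u, a} \<in> B"
    using inv unfolding firing_inv_def prod.case by blast+
  define b' where "b' = fire E w b"
  define new where "new = filter (\<lambda>u. u \<notin> insert w F \<and> unstable E b' u \<and> \<not> unstable E b u) vs"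
  define U where "U = {u. {w, u} \<in> E \<and> (w, u) \<notin> P \<and> (u, w) \<notin> P \<and> {w, u} \<notin> B}"
  have step: "eta_step E vs (w # Q, F, b, P, B) = (Q @ new, insert w F, b',
      P \<union> {(w, u) | u. u \<in> U \<and> \<not> unstable E b u}, B \<union> {{w, u} | u. u \<in> U \<and> unstable E b u})"
    by (simp add: eta_step_def Let_def b'_def new_def U_def)
  have w: "w \<notin> set h" using dist by simp
  have ww: "{w, w} \<notin> E" using simple_graph_neq[OF assms(1), of w w] by blast
  have cn: "?cn ?h u = ?cn h u + (if {u, w} \<in> E then 1 else 0)" for u
    unfolding neighbours_Int_append using w by simp
  have b': "b' u = (if u \<in> set ?h then 0 else 1 + int (card (neighbours E u))) - (c u + 1) + ?cn ?h u" for u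
    unfolding b'_def fire_def cn b degree_cone_graph[OF assms(1)] using w ww by auto
  have unst: "unstable E b u \<longleftrightarrow> c u + 1 \<le> ?cn h u" if "u \<notin> set h" for u
    using that by (auto simp: unstable_def b degree_cone_graph[OF assms(1)])
  have unst': "unstable E b' u \<longleftrightarrow> c u + 1 \<le> ?cn ?h u" if "u \<notin> set ?h" for u
    using that by (auto simp: unstable_def b' degree_cone_graph[OF assms(1)])
  have l_iff: "u \<in> set ?l \<longleftrightarrow> u \<in> set h \<or> c u + 1 \<le> ?cn h u" for u
    using Q by auto
  have new: "u \<in> set new \<longleftrightarrow> u \<notin> set ?l \<and> c u + 1 \<le> ?cn ?h u" for u
  proof (cases "u \<in> set ?h")
    case True
    then show ?thesis by (auto simp: new_def F)
  next
    case False
    then have "u \<in> set new \<longleftrightarrow> unstable E b' u \<and> \<not> unstable E b u"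
      using assms(3) by (auto simp: new_def F)
    then show ?thesis
      using unst[of u] unst'[OF False] False l_iff[of u] by auto
  qed
  have q_l: "q u \<le> length h" if "u \<in> set ?l" for u
    using that q_le by (metis in_set_conv_nth)
  have P_tail: "a \<in> set h" if au: "(a, u) \<in> P" for a u
  proof -
    obtain k where k: "a = h ! k" "k < q u"
      using au unfolding P arcs_before_def by blast
    have "q u \<le> length h" using q_l q_out by (metis order_refl)
    with k show ?thesis by simp
  qed
  \<comment> \<open>Arcs start at fired vertices and blank edges contain one, so the edges of
    \<open>w\<close> still untreated are precisely those to unfired vertices.\<close>
  have U: "u \<in> U \<longleftrightarrow> {w, u} \<in> E \<and> u \<notin> set h" for u
  proof
    assume "u \<in> U"
    then show "{w, u} \<in> E \<and> u \<notin> set h"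
      using handled[of u w] unfolding U_def by (auto simp: insert_commute)
  next
    assume u: "{w, u} \<in> E \<and> u \<notin> set h"
    then have "{w, u} \<notin> B" using B[of "{w, u}"] w by auto
    then show "u \<in> U"
      using u P_tail w by (auto simp: U_def)
  qed
  \<comment> \<open>A vertex already in \<open>?l\<close> gains no arc, as its edge to
    \<open>w\<close> is blank or treated earlier. Any other vertex has arcs from all its fired
    neighbours, before and after the step.\<close>
  have P': "P \<union> {(w, u) | u. u \<in> U \<and> \<not> unstable E b u} = arcs_before E ?h q'" (is "?P = _")
  proof (intro set_eqI)
    fix p :: "'v \<times> 'v"
    obtain a u where p: "p = (a, u)" by fastforce
    show "p \<in> ?P \<longleftrightarrow> p \<in> arcs_before E ?h q'"
    proof (cases "u \<in> set ?l")
      case True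
      then have "p \<in> ?P \<longleftrightarrow> (a, u) \<in> P"
        using U unst[of u] l_iff[of u] p by auto
      also have "\<dots> \<longleftrightarrow> (\<exists>k<q u. a = h ! k \<and> {h ! k, u} \<in> E)"
        by (auto simp: P arcs_before_def)
      also have "\<dots> \<longleftrightarrow> (\<exists>k<q u. a = ?h ! k \<and> {?h ! k, u} \<in> E)"
        using q_l[OF True] by (simp add: nth_append cong: conj_cong)
      also have "\<dots> \<longleftrightarrow> p \<in> arcs_before E ?h q'"
        using True by (auto simp: arcs_before_def p q'_def)
      finally show ?thesis .
    next
      case False
      have "a \<in> {a. (a, u) \<in> P} \<longleftrightarrow> a \<in> neighbours E u \<inter> set h"
        using arcs_before_into[of q u h E] q_out[OF False] P by simp
      moreover have "a \<in> {a. (a, u) \<in> arcs_before E ?h q'} \<longleftrightarrow> a \<in> neighbours E u \<inter> set ?h"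
        using False by (subst arcs_before_into) (auto simp: q'_def)
      moreover have "u \<in> U \<and> \<not> unstable E b u \<longleftrightarrow> {u, w} \<in> E"
        using U[of u] unst[of u] l_iff[of u] False by (auto simp: insert_commute)
      ultimately show ?thesis
        by (auto simp: p neighbours_def)
    qed
  qed
  have indeg': "int (indeg ?P u) = c u + 1" if "u \<in> set (?l @ new)" for u
  proof (cases "u \<in> set ?l")
    case True
    then have "{a. (a, u) \<in> ?P} = {a. (a, u) \<in> P}"
      using U[of u] unst[of u] l_iff[of u] by auto
    then show ?thesis using indeg[OF True] by (simp add: indeg_def)
  next
    case False
    then have "c u + 1 \<le> ?cn ?h u" "\<not> c u + 1 \<le> ?cn h u"
      using that new[of u] l_iff[of u] by auto
    \<comment> \<open>One firing raises the number of fired neighbours by at most one, so the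
      threshold \<open>c u + 1\<close> is met exactly when it is first reached.\<close>
    then have "c u + 1 = ?cn ?h u" using cn[of u] by (auto split: if_splits)
    moreover have "{a. (a, u) \<in> ?P} = neighbours E u \<inter> set ?h"
      unfolding P' using False by (intro arcs_before_into) (simp add: q'_def)
    ultimately show ?thesis by (simp add: indeg_def)
  qed
  have q'_new: "q' u = Suc (length h)" if "u \<in> set new" for u
    using that new[of u] by (auto simp: q'_def)
  have q'_old: "q' u = q u" if "u \<in> set ?l" for u
    using that by (simp add: q'_def)
  have queue: "set (Q @ new) = {u. u \<notin> set ?h \<and> c u + 1 \<le> ?cn ?h u}"
  proof (rule set_eqI)
    fix u
    have "u \<in> set Q \<longleftrightarrow> u \<notin> set ?h \<and> c u + 1 \<le> ?cn h u"
      using Q dist by (metis (no_types, lifting) distinct.simps(2) distinct_append insert_iff list.set(2)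
          mem_Collect_eq set_append Un_iff empty_set list.set(1) singletonD singletonI)
    moreover have "?cn h u \<le> ?cn ?h u" using cn[of u] by simp
    ultimately show "u \<in> set (Q @ new) \<longleftrightarrow> u \<in> {u. u \<notin> set ?h \<and> c u + 1 \<le> ?cn ?h u}"
      using new[of u] by auto
  qed
  have l': "?h @ Q @ new = ?l @ new" by simp
  have dist': "distinct (?l @ new)"
  proof -
    have "distinct new" unfolding new_def using assms(2) by simp
    moreover have "set ?l \<inter> set new = {}" using new by blast
    ultimately show ?thesis using dist by (metis distinct_append)
  qed
  have q_le': "q' ((?l @ new) ! k) \<le> k \<and> q' ((?l @ new) ! k) \<le> length ?h"
    if "k < length (?l @ new)" for k
  proof (cases "k < length ?l")
    case True
    then have "(?l @ new) ! k = ?l ! k" by (simp only: nth_append if_True)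
    moreover have "?l ! k \<in> set ?l" using True by (rule nth_mem)
    ultimately show ?thesis using q_le[OF True] q'_old[of "?l ! k"] by simp
  next
    case False
    then have "(?l @ new) ! k = new ! (k - length ?l)" by (simp only: nth_append if_False)
    moreover have "k - length ?l < length new" using that False by simp
    ultimately have "(?l @ new) ! k \<in> set new" by simp
    then show ?thesis using q'_new False by simp
  qed
  \<comment> \<open>First-in first-out: the newly unstable vertices join at the end with the largest
    value of \<open>q'\<close>.\<close>
  have sorted': "sorted (map q' (?l @ new))"
  proof -
    have eq: "map q' ?l = map q ?l" using q'_old by (intro map_cong) auto
    have "sorted (map q' xs)" if "\<forall>u\<in>set xs. q' u = Suc (length h)" for xs
      using that by (induction xs) auto
    then have "sorted (map q' new)" using q'_new by blast
    moreover have "a \<le> b" if "a \<in> set (map q ?l)" "b \<in> set (map q' new)" for a b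
    proof -
      have "a \<le> length h" using that(1) q_l unfolding set_map by blast
      moreover have "b = Suc (length h)" using that(2) q'_new unfolding set_map by blast
      ultimately show ?thesis by simp
    qed
    ultimately have "sorted (map q' ?l @ map q' new)"
      unfolding eq sorted_append using q_sorted by blast
    then show ?thesis by (subst map_append[of q' ?l new])
  qed
  have handled': "(u, a) \<in> ?P \<or> (a, u) \<in> ?P \<or> {u, a} \<in> B \<union> {{w, u} | u. u \<in> U \<and> unstable E b u}"
    if "u \<in> set ?h" "{u, a} \<in> E" for u a
  proof (cases "u \<in> set h")
    case True
    then show ?thesis using handled that by blast
  next
    case False
    then have [simp]: "u = w" using that by simp
    show ?thesis
    proof (cases "a \<in> set h")
      case True
      then have "(a, w) \<in> P \<or> (w, a) \<in> P \<or> {a, w} \<in> B"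
        using handled[of a w] that by (simp add: insert_commute)
      then show ?thesis by (auto simp: insert_commute)
    next
      case False
      then have "a \<in> U" using U that by simp
      then show ?thesis by auto
    qed
  qed
  show ?thesis
    unfolding step firing_inv_def prod.case l'
  proof (intro conjI)
    show "\<forall>u. u \<notin> set (?l @ new) \<longrightarrow> q' u = length ?h" by (simp add: q'_def)
    show "\<forall>e\<in>B \<union> {{w, u} | u. u \<in> U \<and> unstable E b u}. e \<inter> set ?h \<noteq> {}" using B by fastforce
  qed (use F dist' b' queue P' indeg' q_le' sorted' handled' in \<open>simp_all only: set_append, auto\<close>)
qed

lemma eta_spec:
  fixes E :: "'v::finite set set"
  assumes "simple_graph E" "c \<in> quasi_superstable E" "distinct vs" "set vs = UNIV"
  obtains h q where "distinct h" "set h = UNIV" "eta E vs c = arcs_before E h q"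
    "\<And>u. int (indeg (eta E vs c) u) = c u + 1"
    "\<And>k. k < length h \<Longrightarrow> q (h ! k) \<le> k" "sorted (map q h)"
proof -
  let ?b = "\<lambda>(Q, _). Q \<noteq> []" and ?s = "eta_step E vs"
  let ?I = "\<lambda>s. \<exists>h q. firing_inv E c h q s"
  let ?f = "\<lambda>(Q, F, _). card (- F)"
  note qs = assms(2)[unfolded quasi_superstable_iff[OF assms(1)]]
  have step: "?I (?s s) \<and> ?f (?s s) < ?f s" if inv: "?I s" and "?b s" for s
  proof -
    obtain w Q F b P B where s: "s = (w # Q, F, b, P, B)"
      using \<open>?b s\<close> by (cases s) (auto simp: neq_Nil_conv)
    obtain h q where hq: "firing_inv E c h q (w # Q, F, b, P, B)"
      using inv s by blast
    then have "w \<notin> F" by (auto simp: firing_inv_def)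
    then have "card (- insert w F) < card (- F)"
      by (intro psubset_card_mono) auto
    then have "?f (?s s) < ?f s" by (simp add: s eta_step_def Let_def)
    moreover have "?I (?s s)"
      using firing_inv_step[OF assms(1,3,4) hq] unfolding s by blast
    ultimately show ?thesis by blast
  qed
  have init: "?I (eta_init E vs c)"
    using firing_inv_init[OF assms(1) _ assms(3,4)] qs by blast
  obtain t where t: "while_option ?b ?s (eta_init E vs c) = Some t"
    using measure_while_option_Some[of ?I ?b ?s ?f, OF step init] by blast
  have "?I t"
    by (rule while_option_rule[where P = ?I, OF conjunct1[OF step] t init])
  then obtain h q where inv: "firing_inv E c h q t" by blast
  obtain F b P B where tt: "t = ([], F, b, P, B)"
    using while_option_stop[OF t] by (cases t) auto
  have eta: "eta E vs c = P" by (simp add: eta_def t tt)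
  have inv: "distinct h" "{u. u \<notin> set h \<and> c u + 1 \<le> int (card (neighbours E u \<inter> set h))} = {}"
    "P = arcs_before E h q" "\<forall>u\<in>set h. int (indeg P u) = c u + 1"
    "\<forall>k<length h. q (h ! k) \<le> k" "sorted (map q h)"
    using inv unfolding tt by (auto simp: firing_inv_def)
  \<comment> \<open>Superstability applied to the unfired vertices yields one with more than
    \<open>c u\<close> fired neighbours; it would still be in the queue, which is empty.\<close>
  have all: "set h = UNIV"
  proof (rule ccontr)
    assume "set h \<noteq> UNIV"
    then have "- set h \<noteq> {}" by auto
    then obtain u where "u \<in> - set h" "c u < int (card (neighbours E u - - set h))"
      using conjunct2[OF qs, rule_format, of "- set h"] by blast
    then show False using inv(2) by (auto simp: Diff_eq)
  qed
  show ?thesis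
    by (rule that[of h q]) (use inv all eta in auto)
qed

section \<open>From the firing order to a point of the region\<close>

lemma psi_eta:
  assumes "simple_graph E" "c \<in> quasi_superstable E" "distinct vs" "set vs = UNIV"
  shows "psi (eta E vs c) = c"
  using eta_spec[OF assms] by (force simp: psi_def)

text \<open>The vertex at place \<open>k\<close> of the firing order waits from
  \<open>q (h ! k)\<close> to \<open>k\<close>. Both ends are monotone in \<open>k\<close>, so no
  interval is nested in another and unit intervals realize the same pattern; their positions are the
  coordinates of the required point.\<close>

lemma rho_eta:
  fixes E :: "'v::finite set set"
  assumes "simple_graph E" "c \<in> quasi_superstable E" "distinct vs" "set vs = UNIV"
  shows "partial_orientation E (eta E vs c)" "rho E (eta E vs c) \<noteq> {}"
proof -
  obtain h q where h: "distinct h" "set h = UNIV" "eta E vs c = arcs_before E h q"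
    "\<And>k. k < length h \<Longrightarrow> q (h ! k) \<le> k" "sorted (map q h)"
    using eta_spec[OF assms] by metis
  obtain X :: "nat \<Rightarrow> real" where X: "\<forall>k < length h. \<forall>i < k. X i < X k \<and>
      (i < q (h ! k) \<longrightarrow> X i + 1 < X k) \<and> (q (h ! k) \<le> i \<longrightarrow> X k < X i + 1)"
    using unit_interval_realization[of "length h" "\<lambda>k. q (h ! k)"] h(4,5)
    by (auto simp: sorted_iff_nth_mono)
  define ix where "ix u = (THE k. k < length h \<and> h ! k = u)" for u
  have ix: "ix (h ! k) = k" if "k < length h" for k
    unfolding ix_def using that h(1) by (intro the_equality) (auto simp: nth_eq_iff_index_eq)
  have ex_ix: "\<exists>k<length h. u = h ! k" for u
    using h(2) by (metis UNIV_I in_set_conv_nth)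
  define x :: "real ^ 'v" where "x = (\<chi> u. X (ix u))"
  have x: "x $ (h ! k) = X k" if "k < length h" for k
    using ix[OF that] by (simp add: x_def)
  have "x \<in> rho E (arcs_before E h q)"
    unfolding rho_iff
  proof (intro conjI allI impI ballI; clarify?)
    fix a u assume "(a, u) \<in> arcs_before E h q"
    then obtain i where i: "a = h ! i" "i < q u" by (auto simp: arcs_before_def)
    obtain k where k: "k < length h" "u = h ! k" using ex_ix by blast
    have "i < k" using i k h(4) by fastforce
    then show "x $ a + 1 < x $ u" using X i k x by simp
  next
    fix a u assume au: "{a, u} \<in> E" "(a, u) \<notin> arcs_before E h q" "(u, a) \<notin> arcs_before E h q"
    obtain i k where ik: "i < length h" "a = h ! i" "k < length h" "u = h ! k"
      using ex_ix by metis
    have "a \<noteq> u" by (rule simple_graph_neq[OF assms(1) au(1)])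
    then have "i \<noteq> k" using ik by auto
    \<comment> \<open>On a blank edge neither end fired before the other became unstable: the
      intervals overlap, so the positions differ by less than 1.\<close>
    have "\<not> i < q u" "\<not> k < q a"
      using au ik by (auto simp: arcs_before_def insert_commute)
    then have "\<bar>X i - X k\<bar> < 1"
      using X[rule_format, of k i] X[rule_format, of i k] ik \<open>i \<noteq> k\<close> by (cases i k rule: linorder_cases) auto
    then show "\<bar>x $ a - x $ u\<bar> < 1" using ik x by simp
  qed
  then show "rho E (eta E vs c) \<noteq> {}" "partial_orientation E (eta E vs c)"
    using partial_orientation_of_rho[of x E "eta E vs c"] h(3) by (auto simp: arcs_before_def)
qed

theorem theorem3p13:
  fixes E :: "'v::finite set set"
    and n :: nat
    and v :: "nat \<Rightarrow> 'v"
    and enum :: "(real ^ 'v) set set \<Rightarrow> (real ^ 'v) set list"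
  assumes "simple_graph E"
    and "connected_graph E"
    and "bij_betw v {0..n} UNIV"
    and "\<And>R. finite R \<Longrightarrow> distinct (enum R) \<and> set (enum R) = R"
  shows
    "(\<forall>k r Q L. (label_step E enum ^^ k) (label_init E) = (r # Q, L) \<longrightarrow>
        (\<forall>r' \<in> unlabeled_neighbours E L r. \<exists>!p. crosses r r' p)) \<and>
     (\<exists>L. label_run E enum = Some ([], L) \<and> dom L = regions E) \<and>
     (\<forall>r \<in> regions E. region_label E enum r = psi (tau E r)) \<and>
     region_label E enum ` regions E = quasi_superstable E \<and>
     (\<forall>\<sigma>. \<sigma> permutes {0..n} \<longrightarrow>
        (let \<eta> = eta E (map (v \<circ> \<sigma>) [0..<Suc n]) in
           \<eta> ` quasi_superstable E \<subseteq> semiorientations E \<and>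
           inj_on \<eta> (quasi_superstable E) \<and>
           (\<forall>c \<in> quasi_superstable E.
              rho E (\<eta> c) \<in> regions E \<and> region_label E enum (rho E (\<eta> c)) = c)))"
proof -
  have enum: "\<forall>R. finite R \<longrightarrow> distinct (enum R) \<and> set (enum R) = R"
    using assms(4) by blast
  obtain L where L: "label_run E enum = Some ([], L)" "dom L = regions E"
    "\<And>r. r \<in> regions E \<Longrightarrow> L r = Some (psi (tau E r))"
    using label_run_terminates[OF assms(1) enum] by metis
  have label: "region_label E enum r = psi (tau E r)" if "r \<in> regions E" for r
    using L(1) L(3)[OF that] by (simp add: region_label_def)
  have crossing: "\<exists>!p. crosses r r' p"
    if "(label_step E enum ^^ k) (label_init E) = (r # Q, L)" "r' \<in> unlabeled_neighbours E L r" for k r Q L r'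
    using label_inv_unlabeled_neighbour[OF assms(1) _ that(2)] label_inv_funpow[OF assms(1) enum, of k] that(1)
    by metis
  have eta: "eta E vs c \<in> semiorientations E" "rho E (eta E vs c) \<in> regions E"
    "region_label E enum (rho E (eta E vs c)) = c"
    if "c \<in> quasi_superstable E" "distinct vs" "set vs = UNIV" for vs c
  proof -
    note po = rho_eta[OF assms(1) that]
    show "eta E vs c \<in> semiorientations E"
      by (rule semiorientation_of_rho[OF po])
    show reg: "rho E (eta E vs c) \<in> regions E"
      by (rule rho_in_regions[OF assms(1) po])
    show "region_label E enum (rho E (eta E vs c)) = c"
      using label[OF reg] tau_rho[OF po] psi_eta[OF assms(1) that] by simp
  qed
  have ordering: "distinct (map (v \<circ> \<sigma>) [0..<Suc n])" "set (map (v \<circ> \<sigma>) [0..<Suc n]) = UNIV"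
    if "\<sigma> permutes {0..n}" for \<sigma>
  proof -
    have "bij_betw (v \<circ> \<sigma>) {0..n} UNIV"
      using bij_betw_trans[OF permutes_imp_bij[OF that] assms(3)] .
    moreover have "set [0..<Suc n] = {0..n}" by auto
    ultimately show "distinct (map (v \<circ> \<sigma>) [0..<Suc n])" "set (map (v \<circ> \<sigma>) [0..<Suc n]) = UNIV"
      unfolding bij_betw_def distinct_map set_map by simp_all
  qed
  have range: "region_label E enum ` regions E = quasi_superstable E"
  proof
    show "region_label E enum ` regions E \<subseteq> quasi_superstable E"
      using label psi_tau_quasi_superstable[OF assms(1)] by auto
    show "quasi_superstable E \<subseteq> region_label E enum ` regions E"
      \<comment> \<open>A single ordering suffices for surjectivity; the identity permutation
        supplies it.\<close>
      using eta(2,3) ordering[OF permutes_id] by (metis image_eqI subsetI)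
  qed
  have orderings: "let \<eta> = eta E (map (v \<circ> \<sigma>) [0..<Suc n]) in
       \<eta> ` quasi_superstable E \<subseteq> semiorientations E \<and> inj_on \<eta> (quasi_superstable E) \<and>
       (\<forall>c \<in> quasi_superstable E.
          rho E (\<eta> c) \<in> regions E \<and> region_label E enum (rho E (\<eta> c)) = c)"
    if "\<sigma> permutes {0..n}" for \<sigma>
  proof -
    note e = eta[OF _ ordering[OF that]]
    \<comment> \<open>The label of \<open>rho E (eta E vs c)\<close> returns \<open>c\<close>, so
      \<open>eta\<close> has a left inverse.\<close>
    have "inj_on (eta E (map (v \<circ> \<sigma>) [0..<Suc n])) (quasi_superstable E)"
      by (rule inj_onI) (metis e(3))
    then show ?thesis
      unfolding Let_def using e by blast
  qed
  have run: "\<exists>L. label_run E enum = Some ([], L) \<and> dom L = regions E"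
    using L(1,2) by blast
  show ?thesis
    by (intro conjI allI impI ballI)
      (fact run range | rule crossing label orderings, assumption+)+
qed

end
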